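(* Let $(X_t)_{t\ge 0}$ be an irreducible, nonexplosive birth--death process on $\mathbb{N}$ with birth rates $\lambda$, death rates $\nu$ and semigroup $(P_t)_{t\ge0}$. Let $u:\mathbb{N}\to(0,\infty)$, with associated $u$-modification $(X_{u,t})_{t\ge0}$, discrete gradient $\partial_u$ and potential $V_u$, and assume that $V_u$ is bounded from below. Let $f:\mathbb{N}\to\mathbb{R}$ be such that $\sup_{y\in\mathbb{N}}|\partial_u f(y)|<\infty$, and let $x\in\mathbb{N}$ and $t\ge 0$. Then $$\partial_u P_t f(x)=P_{u,t}^{V_u}\,\partial_u f(x)=\mathbb{E}_x\left[\partial_u f(X_{u,t})\exp\left(-\int_0^t V_u(X_{u,s})\,ds\right)\right].$$ Moreover, let $\varphi:\mathbb{R}\to\mathbb{R}$ be a smooth convex function for which there is a constant $c>0$ such that $\varphi'(r)\,r\ge c\,\varphi(r)$ for all $r\in\mathbb{R}$. If $V_u\ge 0$, then $$\varphi(\partial_u P_t f)(x)\le \mathbb{E}_x\left[\varphi(\partial_u f)(X_{u,t})\exp\left(-\int_0^t c\,V_u(X_{u,s})\,ds\right)\right].$$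
   Context: $\mathbb{N}=\{0,1,2,\dots\}$. A birth--death process $(X_t)_{t\ge0}$ with birth rates $\lambda_x$ and death rates $\nu_x$ is the continuous-time Markov chain on $\mathbb{N}$ with generator $\mathcal{L}f(x)=\lambda_x\,\partial f(x)+\nu_x\,\partial^* f(x)$, where $\partial f(x)=f(x+1)-f(x)$, $\partial^*f(x)=f(x-1)-f(x)$; its semigroup is $P_tf(x)=\mathbb{E}_x[f(X_t)]$. Irreducible means $\lambda_x>0$ for all $x\in\mathbb{N}$, $\nu_x>0$ for all $x\ge1$ and $\nu_0=0$. Nonexplosive means $\sum_{x\ge1}\left(\frac1{\lambda_x}+\frac{\nu_x}{\lambda_x\lambda_{x-1}}+\cdots+\frac{\nu_x\cdots\nu_1}{\lambda_x\cdots\lambda_1\lambda_0}\right)=\infty$. For $u:\mathbb{N}\to(0,\infty)$: the $u$-modification $(X_{u,t})_{t\ge0}$ is the (minimal) birth--death process with birth rates $\lambda^u_x=\frac{u_{x+1}}{u_x}\lambda_{x+1}$ and death rates $\nu^u_x=\frac{u_{x-1}}{u_x}\nu_x$ (so $\nu^u_0=0$), with semigroup $P_{u,t}g(x)=\mathbb{E}_x[g(X_{u,t})]$ (quantities being taken equal to $0$ after a possible explosion). Here $\mathbb{E}_x$ means that the process starts at $x$. The discrete gradient is $\partial_u f=(1/u)\,\partial f$ and the potential is $V_u(x)=\nu_{x+1}-\nu^u_x+\lambda_x-\lambda^u_x$. For a potential $V$, the Feynman--Kac semigroup is $P_{u,t}^{V}g(x)=\mathbb{E}_x\left[g(X_{u,t})\exp\left(-\int_0^tV(X_{u,s})\,ds\right)\right]$.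 Standing assumption: $\lambda^u$, $\nu^u$ and $V_u$ are $P_{u,t}$-integrable, i.e. $P_{u,t}(\lambda^u+\nu^u+|V_u|)(x)<\infty$ for all $x\in\mathbb{N}$, $t\ge0$. *)

theory Defs
  imports "HOL-Probability.Probability"
begin

section \<open>Minimal Markov chains on the natural numbers with a given generator\<close>

text \<open>
  The rates of a generator are the entries of its matrix: the rate of a jump from x to y is
  the value at x of the generator applied to the indicator function of y.
\<close>

definition jump_rate :: "((nat \<Rightarrow> real) \<Rightarrow> nat \<Rightarrow> real) \<Rightarrow> nat \<Rightarrow> nat \<Rightarrow> real" where
  "jump_rate L x y = (if x = y then 0 else L (indicator {y}) x)"

definition exit_rate :: "((nat \<Rightarrow> real) \<Rightarrow> nat \<Rightarrow> real) \<Rightarrow> nat \<Rightarrow> real" where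
  "exit_rate L x = - L (indicator {x}) x"

text \<open>
  The path that visits the states Y 0, Y 1, ... with holding times S 0, S 1, ...  The n-th state is
  occupied during the half-open interval from S 0 + ... + S (n - 1) to S 0 + ... + S n, and
  the value None is the cemetery, reached when all the jump times are at most t, i.e. after explosion.
\<close>

definition jump_path :: "(nat \<Rightarrow> nat) \<Rightarrow> (nat \<Rightarrow> real) \<Rightarrow> real \<Rightarrow> nat option" where
  "jump_path Y S t =
     (if \<exists>n. t < (\<Sum>i\<le>n. S i) then Some (Y (LEAST n. t < (\<Sum>i\<le>n. S i))) else None)"

text \<open>
  The minimal continuous-time Markov chain with generator L, by its jump chain Y and its
  holding times S.  P x is the law under which the chain starts at x.  The last clause says that
  under P x the sequence Y is a Markov chain started at x with transition
  probabilities jump_rate L a b / exit_rate L a, and that given Y the holding times are independent,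
  S i being exponential with parameter exit_rate L (Y i).  The definition is meant
  for generators without absorbing states, i.e. with positive exit rates.
\<close>

definition minimal_chain ::
  "((nat \<Rightarrow> real) \<Rightarrow> nat \<Rightarrow> real) \<Rightarrow> (nat \<Rightarrow> 'w measure) \<Rightarrow> (real \<Rightarrow> 'w \<Rightarrow> nat option) \<Rightarrow> bool" where
  "minimal_chain L P X \<longleftrightarrow>
     (\<exists>Y S. \<forall>x.
        prob_space (P x) \<and>
        (\<forall>n. Y n \<in> P x \<rightarrow>\<^sub>M count_space UNIV) \<and>
        (\<forall>n. S n \<in> borel_measurable (P x)) \<and>
        (\<forall>\<omega>\<in>space (P x). \<forall>n. 0 < S n \<omega>) \<and>
        (\<forall>\<omega>\<in>space (P x). \<forall>t\<ge>0. X t \<omega> = jump_path (\<lambda>n. Y n \<omega>) (\<lambda>n. S n \<omega>) t) \<and>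
        (\<forall>n y s. (\<forall>i\<le>n. 0 \<le> s i) \<longrightarrow>
           measure (P x) {\<omega> \<in> space (P x). \<forall>i\<le>n. Y i \<omega> = y i \<and> s i < S i \<omega>} =
             (if y 0 = x then 1 else 0) *
             (\<Prod>i<n. jump_rate L (y i) (y (Suc i)) / exit_rate L (y i)) *
             (\<Prod>i\<le>n. exp (- (exit_rate L (y i) * s i)))))"

text \<open>Functions on the natural numbers take the value 0 at the cemetery.\<close>

definition ext :: "(nat \<Rightarrow> real) \<Rightarrow> nat option \<Rightarrow> real" where
  "ext g z = (case z of None \<Rightarrow> 0 | Some y \<Rightarrow> g y)"

definition chain_semigroup ::
  "(nat \<Rightarrow> 'w measure) \<Rightarrow> (real \<Rightarrow> 'w \<Rightarrow> nat option) \<Rightarrow> real \<Rightarrow> (nat \<Rightarrow> real) \<Rightarrow> nat \<Rightarrow> real" where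
  "chain_semigroup P X t g x = (\<integral>\<omega>. ext g (X t \<omega>) \<partial>P x)"

definition fk_functional ::
  "(real \<Rightarrow> 'w \<Rightarrow> nat option) \<Rightarrow> (nat \<Rightarrow> real) \<Rightarrow> real \<Rightarrow> (nat \<Rightarrow> real) \<Rightarrow> 'w \<Rightarrow> real" where
  "fk_functional X V t g \<omega> = ext g (X t \<omega>) * exp (- (LINT s:{0..t}|lborel. ext V (X s \<omega>)))"

definition fk_semigroup ::
  "(nat \<Rightarrow> 'w measure) \<Rightarrow> (real \<Rightarrow> 'w \<Rightarrow> nat option) \<Rightarrow> (nat \<Rightarrow> real) \<Rightarrow> real \<Rightarrow> (nat \<Rightarrow> real) \<Rightarrow> nat \<Rightarrow> real" where
  "fk_semigroup P X V t g x = (\<integral>\<omega>. fk_functional X V t g \<omega> \<partial>P x)"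


section \<open>Birth--death processes and their modifications\<close>

definition fwd_diff :: "(nat \<Rightarrow> real) \<Rightarrow> nat \<Rightarrow> real" where
  "fwd_diff f x = f (x + 1) - f x"

text \<open>At 0 the truncated subtraction gives the value 0; it is multiplied by the death rate 0 there.\<close>

definition bwd_diff :: "(nat \<Rightarrow> real) \<Rightarrow> nat \<Rightarrow> real" where
  "bwd_diff f x = f (x - 1) - f x"

definition bd_generator :: "(nat \<Rightarrow> real) \<Rightarrow> (nat \<Rightarrow> real) \<Rightarrow> (nat \<Rightarrow> real) \<Rightarrow> nat \<Rightarrow> real" where
  "bd_generator lam nu f x = lam x * fwd_diff f x + nu x * bwd_diff f x"

definition birth_death_process ::
  "(nat \<Rightarrow> real) \<Rightarrow> (nat \<Rightarrow> real) \<Rightarrow> (nat \<Rightarrow> 'w measure) \<Rightarrow> (real \<Rightarrow> 'w \<Rightarrow> nat option) \<Rightarrow> bool" where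
  "birth_death_process lam nu P X \<longleftrightarrow> minimal_chain (bd_generator lam nu) P X"

definition bd_irreducible :: "(nat \<Rightarrow> real) \<Rightarrow> (nat \<Rightarrow> real) \<Rightarrow> bool" where
  "bd_irreducible lam nu \<longleftrightarrow> (\<forall>x. 0 < lam x) \<and> (\<forall>x\<ge>1. 0 < nu x) \<and> nu 0 = 0"

text \<open>
  The summand k = x is 1 / lam x, and the summand k = 0 is
  (nu x ... nu 1) / (lam x ... lam 0).
\<close>

definition bd_nonexplosive :: "(nat \<Rightarrow> real) \<Rightarrow> (nat \<Rightarrow> real) \<Rightarrow> bool" where
  "bd_nonexplosive lam nu \<longleftrightarrow>
     \<not> summable (\<lambda>n. let x = Suc n in \<Sum>k\<le>x. (\<Prod>j\<in>{k<..x}. nu j) / (\<Prod>j\<in>{k..x}. lam j))"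

definition mod_birth :: "(nat \<Rightarrow> real) \<Rightarrow> (nat \<Rightarrow> real) \<Rightarrow> nat \<Rightarrow> real" where
  "mod_birth u lam x = u (x + 1) / u x * lam (x + 1)"

definition mod_death :: "(nat \<Rightarrow> real) \<Rightarrow> (nat \<Rightarrow> real) \<Rightarrow> nat \<Rightarrow> real" where
  "mod_death u nu x = u (x - 1) / u x * nu x"

definition u_grad :: "(nat \<Rightarrow> real) \<Rightarrow> (nat \<Rightarrow> real) \<Rightarrow> nat \<Rightarrow> real" where
  "u_grad u f x = (1 / u x) * fwd_diff f x"

definition potential :: "(nat \<Rightarrow> real) \<Rightarrow> (nat \<Rightarrow> real) \<Rightarrow> (nat \<Rightarrow> real) \<Rightarrow> nat \<Rightarrow> real" where
  "potential u lam nu x = nu (x + 1) - mod_death u nu x + lam x - mod_birth u lam x"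

definition smooth_fun :: "(real \<Rightarrow> real) \<Rightarrow> bool" where
  "smooth_fun \<phi> \<longleftrightarrow> (\<forall>k r. (deriv ^^ k) \<phi> field_differentiable (at r))"

end

theory Submission
  imports Defs
begin

text \<open>
  Write L for the generator of the given process, A for the operator
  L_u - V_u, where L_u is the generator of the u-modification, and grad f for the weighted
  difference (f (x + 1) - f x) / u x.  A direct computation gives the generator identity
  grad (L f) = A (grad f), and the theorem is its exponentiated form.

  The birth--death generator and the Feynman--Kac operator are both tridiagonal matrices with
  rates a, b off the diagonal and -r on it, and their semigroups, with functions set to 0 after
  explosion, are the minimal nonnegative solutions of the backward equation.  They are
  obtained as limits of Picard iterates, the m-th of which accounts for the paths
  with fewer than m jumps (fk_iter, fk_min).  Decomposing at the first jump identifies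
  these iterates with expectations (birth_death_feynman_kac).  So the claim becomes one about
  minimal solutions.

  Reflecting L at N, that is, suppressing the birth at N, corresponds under grad to killing A when it leaves
  {0, ..., N - 1}: the diagonal entry of A at N - 1 still contains the death rate of the reflected
  process at N, while the birth rate of A at N - 1 disappears.  For these finite systems both sides of the
  intertwining solve the same linear equation with the same initial value, hence agree
  (finite_intertwining).  As N grows, the killed A-semigroups increase to the minimal one by
  construction.  The reflected semigroups converge to that of the original process because they dominate
  the semigroups killed above N and differ from them by at most a multiple of the lost mass, which tends to 0 by
  nonexplosion (reflected_tendsto_sem).  The lost mass is controlled by the increasing solution
  F of L F = F, which Feller's criterion makes unbounded (killed_mass_ge).

  In this form the identity holds for bounded increasing functions.  Unbounded increasing functions are reached by
  stopping them at level k, and the lower bound on the potential gives the a priori bound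
  exp (K t) sup (grad f) that makes the limits finite; a general f is the difference of two increasing
  functions.

  The inequality for convex functions combines Jensen's inequality for the random variable
  grad f(X_u) exp (- I), where I is the integral of V_u along the path, with the pointwise bound
  \<phi> (r exp (- I)) \<le> exp (- c I) \<phi> r (dissipation_bound).  On explosion the random variable is 0, and
  the hypothesis at r = 0 gives \<phi> 0 \<le> 0.
\<close>

section \<open>Minimal solutions of tridiagonal backward equations\<close>

text \<open>
  Picard iterates, started from 0, of the integrated backward equation
  w' = a w(x+1) + b w(x-1) - r w with initial value g.  The values are extended nonnegative reals,
  so that no integrability has to be carried through the limits.  At x = 0 the truncated
  x - 1 is harmless, since the rate b 0 vanishes in all applications.
\<close>

fun fk_iter :: "(nat \<Rightarrow> real) \<Rightarrow> (nat \<Rightarrow> real) \<Rightarrow> (nat \<Rightarrow> real) \<Rightarrow> (nat \<Rightarrow> real) \<Rightarrow>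
    nat \<Rightarrow> real \<Rightarrow> nat \<Rightarrow> ennreal" where
  "fk_iter a b r g 0 t x = 0"
| "fk_iter a b r g (Suc m) t x = ennreal (g x * exp (- (r x * t))) +
     (\<integral>\<^sup>+ s. indicator {0..t} s * ennreal (exp (- (r x * (t - s)))) *
        (ennreal (a x) * fk_iter a b r g m s (x + 1) + ennreal (b x) * fk_iter a b r g m s (x - 1)) \<partial>lborel)"

definition fk_min :: "(nat \<Rightarrow> real) \<Rightarrow> (nat \<Rightarrow> real) \<Rightarrow> (nat \<Rightarrow> real) \<Rightarrow> (nat \<Rightarrow> real) \<Rightarrow>
    real \<Rightarrow> nat \<Rightarrow> ennreal" where
  "fk_min a b r g t x = (SUP m. fk_iter a b r g m t x)"

lemma fk_iter_measurable [measurable]: "(\<lambda>t. fk_iter a b r g m t x) \<in> borel_measurable borel"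
proof (induction m arbitrary: x)
  case (Suc m)
  note [measurable] = Suc
  have *: "{0..t} = {s. 0 \<le> s \<and> s \<le> t}" for t :: real by auto
  show ?case unfolding fk_iter.simps * by measurable
qed simp

lemma fk_min_measurable [measurable]: "(\<lambda>t. fk_min a b r g t x) \<in> borel_measurable borel"
  unfolding fk_min_def by measurable

lemma fk_iter_mono:
  assumes "\<And>y. a y \<le> a' y" "\<And>y. b y \<le> b' y" "\<And>y. r' y \<le> r y" "\<And>y. g y \<le> g' y"
    and "\<And>y. 0 \<le> g' y" "0 \<le> t"
  shows "fk_iter a b r g m t x \<le> fk_iter a' b' r' g' m t x"
  using \<open>0 \<le> t\<close>
proof (induction m arbitrary: t x)
  case (Suc m)
  have e: "exp (- (r x * c)) \<le> exp (- (r' x * c))" if "0 \<le> c" for c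
    using assms(3)[of x] that by (simp add: mult_right_mono)
  have 1: "ennreal (g x * exp (- (r x * t))) \<le> ennreal (g' x * exp (- (r' x * t)))"
  proof (rule ennreal_leI)
    have "g x * exp (- (r x * t)) \<le> g' x * exp (- (r x * t))"
      using assms(4)[of x] by (intro mult_right_mono) auto
    also have "\<dots> \<le> g' x * exp (- (r' x * t))"
      using e[OF Suc.prems] assms(5)[of x] by (intro mult_left_mono) auto
    finally show "g x * exp (- (r x * t)) \<le> g' x * exp (- (r' x * t))" .
  qed
  show ?case unfolding fk_iter.simps
  proof (intro add_mono nn_integral_mono 1)
    fix s :: real
    show "indicator {0..t} s * ennreal (exp (- (r x * (t - s)))) *
        (ennreal (a x) * fk_iter a b r g m s (x + 1) + ennreal (b x) * fk_iter a b r g m s (x - 1))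
      \<le> indicator {0..t} s * ennreal (exp (- (r' x * (t - s)))) *
        (ennreal (a' x) * fk_iter a' b' r' g' m s (x + 1) + ennreal (b' x) * fk_iter a' b' r' g' m s (x - 1))"
    proof (cases "s \<in> {0..t}")
      case True
      then show ?thesis using e[of "t - s"] Suc.IH[of s] assms(1,2)
        by (intro mult_mono add_mono ennreal_leI) auto
    qed auto
  qed
qed simp

lemma fk_iter_Suc_le: "fk_iter a b r g m t x \<le> fk_iter a b r g (Suc m) t x"
proof (induction m arbitrary: t x)
  case (Suc m)
  show ?case
    unfolding fk_iter.simps(2)[of a b r g m t x] fk_iter.simps(2)[of a b r g "Suc m" t x]
    by (intro add_mono nn_integral_mono mult_mono Suc) auto
qed simp

lemma incseq_fk_iter: "incseq (\<lambda>m. fk_iter a b r g m t x)"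
  by (intro incseq_SucI fk_iter_Suc_le)

lemma fk_min_mono:
  assumes "\<And>y. a y \<le> a' y" "\<And>y. b y \<le> b' y" "\<And>y. r' y \<le> r y" "\<And>y. g y \<le> g' y"
    and "\<And>y. 0 \<le> g' y" "0 \<le> t"
  shows "fk_min a b r g t x \<le> fk_min a' b' r' g' t x"
  unfolding fk_min_def by (intro SUP_mono') (rule fk_iter_mono[OF assms])

lemma fk_iter_add:
  assumes "\<And>y. 0 \<le> g y" "\<And>y. 0 \<le> g' y"
  shows "fk_iter a b r (\<lambda>y. g y + g' y) m t x = fk_iter a b r g m t x + fk_iter a b r g' m t x"
proof (induction m arbitrary: t x)
  case (Suc m)
  have "ennreal ((g x + g' x) * exp (- (r x * t))) =
      ennreal (g x * exp (- (r x * t))) + ennreal (g' x * exp (- (r x * t)))"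
    using assms by (simp add: distrib_right)
  then show ?case
    by (simp add: Suc nn_integral_add[symmetric] del: ennreal_plus)
       (simp add: nn_integral_add distrib_left distrib_right ac_simps)
qed simp

lemma fk_min_add:
  assumes "\<And>y. 0 \<le> g y" "\<And>y. 0 \<le> g' y"
  shows "fk_min a b r (\<lambda>y. g y + g' y) t x = fk_min a b r g t x + fk_min a b r g' t x"
  unfolding fk_min_def fk_iter_add[OF assms]
  by (intro ennreal_SUP_add incseq_fk_iter)

text \<open>
  Fewer than m jumps of size one reach no state beyond x + m, so the m-th iterate only sees the
  rates up to there.  This is what makes all the truncation limits below elementary.
\<close>

lemma fk_iter_cong_local:
  assumes "\<And>y. y \<le> x + m \<Longrightarrow> a y = a' y \<and> b y = b' y \<and> r y = r' y \<and> g y = g' y"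
  shows "fk_iter a b r g m t x = fk_iter a' b' r' g' m t x"
  using assms
proof (induction m arbitrary: t x)
  case (Suc m)
  have "fk_iter a b r g m s (x + 1) = fk_iter a' b' r' g' m s (x + 1)"
       "fk_iter a b r g m s (x - 1) = fk_iter a' b' r' g' m s (x - 1)" for s
    using Suc.prems by (auto intro!: Suc.IH)
  moreover have "a x = a' x \<and> b x = b' x \<and> r x = r' x \<and> g x = g' x" using Suc.prems by simp
  ultimately show ?case by simp
qed simp

text \<open>
  Dominated approximations that agree with the limiting data on ever larger initial segments: each
  iterate is eventually exact, and domination gives the reverse inequality.
\<close>

lemma fk_min_tendsto_of_local_agreement:
  assumes loc: "\<And>N y. y \<le> N \<Longrightarrow> a y = a' N y \<and> b y = b' N y \<and> r y = r' N y \<and> g y = g' N y"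
    and le: "\<And>N y. a' N y \<le> a y" "\<And>N y. b' N y \<le> b y" "\<And>N y. r y \<le> r' N y" "\<And>N y. g' N y \<le> g y"
    and g: "\<And>y. 0 \<le> g y" and t: "0 \<le> t"
  shows "(\<lambda>N. fk_min (a' N) (b' N) (r' N) (g' N) t x) \<longlonglongrightarrow> fk_min a b r g t x"
proof (rule tendsto_sandwich)
  show "\<forall>\<^sub>F N in sequentially. fk_min (a' N) (b' N) (r' N) (g' N) t x \<le> fk_min a b r g t x"
    by (intro always_eventually allI fk_min_mono le g t)
  show "\<forall>\<^sub>F N in sequentially. fk_iter a b r g (N - x) t x \<le> fk_min (a' N) (b' N) (r' N) (g' N) t x"
  proof (rule eventually_sequentiallyI[of x])
    fix N assume "x \<le> N"
    then have "fk_iter a b r g (N - x) t x = fk_iter (a' N) (b' N) (r' N) (g' N) (N - x) t x"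
      by (intro fk_iter_cong_local loc) auto
    then show "fk_iter a b r g (N - x) t x \<le> fk_min (a' N) (b' N) (r' N) (g' N) t x"
      unfolding fk_min_def by (auto intro: SUP_upper)
  qed
  have "(\<lambda>m. fk_iter a b r g m t x) \<longlonglongrightarrow> fk_min a b r g t x"
    unfolding fk_min_def by (intro LIMSEQ_SUP incseq_fk_iter)
  then show "(\<lambda>N. fk_iter a b r g (N - x) t x) \<longlonglongrightarrow> fk_min a b r g t x"
    by (rule filterlim_compose) (rule filterlim_minus_const_nat_at_top)
qed auto

text \<open>
  This integral makes exp (K t) w a fixed point of the Picard map when w is
  an eigenvector with eigenvalue K, which is the borderline case of the next induction.
\<close>

lemma nn_integral_exp_convolution:
  assumes "0 \<le> t" "0 \<le> K + r"
  shows "(\<integral>\<^sup>+ s. indicator {0..t} s * ennreal (exp (- (r * (t - s))) * ((K + r) * exp (K * s))) \<partial>lborel)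
    = ennreal (exp (K * t) - exp (- (r * t)))"
proof -
  define F where "F s = exp (- (r * (t - s))) * exp (K * s)" for s
  have "(\<integral>\<^sup>+ s. ennreal (exp (- (r * (t - s))) * ((K + r) * exp (K * s))) * indicator {0..t} s \<partial>lborel)
    = ennreal (F t - F 0)"
  proof (rule nn_integral_FTC_Icc)
    fix s
    show "(F has_real_derivative exp (- (r * (t - s))) * ((K + r) * exp (K * s))) (at s)"
      unfolding F_def
      by (auto intro!: derivative_eq_intros simp: algebra_simps)
    show "0 \<le> exp (- (r * (t - s))) * ((K + r) * exp (K * s))" using assms by simp
  qed (use assms in auto)
  then show ?thesis by (simp add: mult.commute F_def)
qed

text \<open>
  The iterates stay below exp (K t) w for every w \<ge> g that satisfies a w(x+1) + b w(x-1) - r w \<le> K w: the Picard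
  map is monotone and preserves this bound.  With constant w this yields both total mass at most 1 and the a priori bound
  under a potential bounded from below.
\<close>

lemma fk_iter_le_supersolution:
  assumes ab: "\<And>y. 0 \<le> a y" "\<And>y. 0 \<le> b y" and gw: "\<And>y. g y \<le> w y" and w: "\<And>y. 0 < w y"
    and sup: "\<And>y. a y * w (y + 1) + b y * w (y - 1) \<le> (K + r y) * w y"
    and "0 \<le> t"
  shows "fk_iter a b r g m t x \<le> ennreal (exp (K * t) * w x)"
  using \<open>0 \<le> t\<close>
proof (induction m arbitrary: t x)
  case (Suc m)
  note wn = less_imp_le[OF w]
  have "0 \<le> a x * w (x + 1) + b x * w (x - 1)" using ab wn by simp
  then have "0 \<le> (K + r x) * w x" using sup[of x] by linarith
  then have Kr: "0 \<le> K + r x" using w[of x] by (simp add: zero_le_mult_iff)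
  have "fk_iter a b r g (Suc m) t x \<le> ennreal (w x * exp (- (r x * t))) +
     (\<integral>\<^sup>+ s. ennreal (w x) * (indicator {0..t} s * ennreal (exp (- (r x * (t - s))) * ((K + r x) * exp (K * s)))) \<partial>lborel)"
    unfolding fk_iter.simps
  proof (intro add_mono nn_integral_mono ennreal_leI mult_right_mono gw)
    fix s :: real
    show "indicator {0..t} s * ennreal (exp (- (r x * (t - s)))) *
         (ennreal (a x) * fk_iter a b r g m s (x + 1) + ennreal (b x) * fk_iter a b r g m s (x - 1))
         \<le> ennreal (w x) * (indicator {0..t} s * ennreal (exp (- (r x * (t - s))) * ((K + r x) * exp (K * s))))"
    proof (cases "s \<in> {0..t}")
      case True
      then have s: "0 \<le> s" by simp
      have "ennreal (a x) * fk_iter a b r g m s (x + 1) + ennreal (b x) * fk_iter a b r g m s (x - 1)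
        \<le> ennreal (a x) * ennreal (exp (K * s) * w (x + 1)) + ennreal (b x) * ennreal (exp (K * s) * w (x - 1))"
        by (intro add_mono mult_left_mono Suc.IH s) auto
      also have "\<dots> = ennreal (exp (K * s) * (a x * w (x + 1) + b x * w (x - 1)))"
        using ab wn by (simp add: ennreal_mult[symmetric] ennreal_plus[symmetric] algebra_simps del: ennreal_plus)
      also have "\<dots> \<le> ennreal (exp (K * s) * ((K + r x) * w x))"
        by (intro ennreal_leI mult_left_mono sup) auto
      finally have "ennreal (exp (- (r x * (t - s)))) *
         (ennreal (a x) * fk_iter a b r g m s (x + 1) + ennreal (b x) * fk_iter a b r g m s (x - 1))
         \<le> ennreal (exp (- (r x * (t - s)))) * ennreal (exp (K * s) * ((K + r x) * w x))"
        by (rule mult_left_mono) auto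
      also have "\<dots> = ennreal (w x) * ennreal (exp (- (r x * (t - s))) * ((K + r x) * exp (K * s)))"
        using Kr wn by (simp add: ennreal_mult[symmetric] mult_ac)
      finally show ?thesis using True by simp
    qed auto
  qed auto
  also have "\<dots> = ennreal (w x * exp (- (r x * t))) + ennreal (w x) * ennreal (exp (K * t) - exp (- (r x * t)))"
    using Suc.prems Kr by (subst nn_integral_cmult) (auto simp: nn_integral_exp_convolution)
  also have "\<dots> = ennreal (exp (K * t) * w x)"
  proof -
    have "0 \<le> (K + r x) * t" using Kr Suc.prems by simp
    then have "exp (- (r x * t)) \<le> exp (K * t)" by (simp add: algebra_simps)
    then have "ennreal (w x) * ennreal (exp (K * t) - exp (- (r x * t)))
        = ennreal (w x * (exp (K * t) - exp (- (r x * t))))"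
      using wn[of x] by (simp add: ennreal_mult)
    moreover have "0 \<le> w x * (exp (K * t) - exp (- (r x * t)))"
      using wn[of x] \<open>exp (- (r x * t)) \<le> exp (K * t)\<close> by simp
    ultimately show ?thesis using wn[of x]
      by (simp add: ennreal_plus[symmetric] right_diff_distrib mult.commute del: ennreal_plus)
  qed
  finally show ?case .
qed simp

lemma fk_min_le_supersolution:
  assumes "\<And>y. 0 \<le> a y" "\<And>y. 0 \<le> b y" "\<And>y. g y \<le> w y" "\<And>y. 0 < w y"
    and "\<And>y. a y * w (y + 1) + b y * w (y - 1) \<le> (K + r y) * w y"
    and "0 \<le> t"
  shows "fk_min a b r g t x \<le> ennreal (exp (K * t) * w x)"
  unfolding fk_min_def by (intro SUP_least fk_iter_le_supersolution[OF assms])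

lemma fk_min_renewal:
  "fk_min a b r g t x = ennreal (g x * exp (- (r x * t))) +
     (\<integral>\<^sup>+ s. indicator {0..t} s * ennreal (exp (- (r x * (t - s)))) *
        (ennreal (a x) * fk_min a b r g s (x + 1) + ennreal (b x) * fk_min a b r g s (x - 1)) \<partial>lborel)"
proof (rule LIMSEQ_unique)
  show "(\<lambda>m. fk_iter a b r g (Suc m) t x) \<longlonglongrightarrow> fk_min a b r g t x"
    unfolding fk_min_def by (intro LIMSEQ_Suc LIMSEQ_SUP incseq_fk_iter)
  have inc: "incseq (\<lambda>m. indicator {0..t} s * ennreal (exp (- (r x * (t - s)))) *
        (ennreal (a x) * fk_iter a b r g m s (x + 1) + ennreal (b x) * fk_iter a b r g m s (x - 1)))" for s
    by (intro incseq_SucI mult_left_mono add_mono fk_iter_Suc_le) auto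
  have "(\<lambda>m. \<integral>\<^sup>+ s. indicator {0..t} s * ennreal (exp (- (r x * (t - s)))) *
        (ennreal (a x) * fk_iter a b r g m s (x + 1) + ennreal (b x) * fk_iter a b r g m s (x - 1)) \<partial>lborel)
    \<longlonglongrightarrow> (\<integral>\<^sup>+ s. indicator {0..t} s * ennreal (exp (- (r x * (t - s)))) *
        (ennreal (a x) * fk_min a b r g s (x + 1) + ennreal (b x) * fk_min a b r g s (x - 1)) \<partial>lborel)"
  proof (rule nn_integral_LIMSEQ)
    show "incseq (\<lambda>m s. indicator {0..t} s * ennreal (exp (- (r x * (t - s)))) *
        (ennreal (a x) * fk_iter a b r g m s (x + 1) + ennreal (b x) * fk_iter a b r g m s (x - 1)))"
      using inc by (auto simp: incseq_def le_fun_def)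
    fix s :: real
    have lim: "(\<lambda>m. fk_iter a b r g m s y) \<longlonglongrightarrow> fk_min a b r g s y" for y
      unfolding fk_min_def by (intro LIMSEQ_SUP incseq_fk_iter)
    show "(\<lambda>m. indicator {0..t} s * ennreal (exp (- (r x * (t - s)))) *
        (ennreal (a x) * fk_iter a b r g m s (x + 1) + ennreal (b x) * fk_iter a b r g m s (x - 1)))
      \<longlonglongrightarrow> indicator {0..t} s * ennreal (exp (- (r x * (t - s)))) *
        (ennreal (a x) * fk_min a b r g s (x + 1) + ennreal (b x) * fk_min a b r g s (x - 1))"
      by (intro ennreal_tendsto_cmult tendsto_add lim) (auto split: split_indicator simp: ennreal_mult_less_top)
  qed measurable
  then show "(\<lambda>m. fk_iter a b r g (Suc m) t x) \<longlonglongrightarrow> ennreal (g x * exp (- (r x * t))) +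
     (\<integral>\<^sup>+ s. indicator {0..t} s * ennreal (exp (- (r x * (t - s)))) *
        (ennreal (a x) * fk_min a b r g s (x + 1) + ennreal (b x) * fk_min a b r g s (x - 1)) \<partial>lborel)"
    unfolding fk_iter.simps by (intro tendsto_add tendsto_const)
qed

text \<open>
  Local boundedness suffices to differentiate the renewal equation: it first makes the right-hand side
  continuous in time, so that the integrand is continuous, so that the right-hand side is differentiable.
\<close>

lemma fk_min_has_real_derivative:
  fixes a b r g :: "nat \<Rightarrow> real" and B :: "nat \<Rightarrow> real"
  defines "G \<equiv> \<lambda>s y. enn2real (fk_min a b r g s y)"
  assumes ab: "\<And>y. 0 \<le> a y" "\<And>y. 0 \<le> b y" and g: "\<And>y. 0 \<le> g y"
    and fin: "\<And>s y. 0 \<le> s \<Longrightarrow> s \<le> T \<Longrightarrow> fk_min a b r g s y \<le> ennreal (B y)"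
    and t: "0 \<le> t" "t \<le> T"
  shows "((\<lambda>s. G s x) has_real_derivative a x * G t (x + 1) + b x * G t (x - 1) - r x * G t x)
    (at t within {0..T})"
proof -
  have Gfin: "fk_min a b r g s y = ennreal (G s y)" "0 \<le> G s y" "G s y \<le> max 0 (B y)"
    if "0 \<le> s" "s \<le> T" for s y
  proof -
    have "fk_min a b r g s y \<le> ennreal (max 0 (B y))"
      by (rule order_trans[OF fin[OF that]]) (auto intro!: ennreal_leI)
    moreover from this have "fk_min a b r g s y < \<top>"
      by (rule order_le_less_trans) simp
    ultimately show "fk_min a b r g s y = ennreal (G s y)" "0 \<le> G s y" "G s y \<le> max 0 (B y)"
      unfolding G_def by (auto simp: enn2real_leI)
  qed
  have Gm [measurable]: "(\<lambda>s. G s y) \<in> borel_measurable borel" for y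
    unfolding G_def by measurable
  define h where "h y s = exp (r y * s) * (a y * G s (y + 1) + b y * G s (y - 1))" for y s
  have hm [measurable]: "h y \<in> borel_measurable borel" for y
    unfolding h_def by measurable
  have hnn: "0 \<le> h y s" if "0 \<le> s" "s \<le> T" for y s
    using that ab Gfin(2) by (simp add: h_def)
  have hint: "set_integrable lborel {0..s} (h y)" if "s \<le> T" for y s
    unfolding set_integrable_def
  proof (rule integrable_bounded_linear[OF bounded_linear_ident], rule integrableI_bounded_set_indicator)
    show "AE \<sigma> in lborel. \<sigma> \<in> {0..s} \<longrightarrow> norm (h y \<sigma>) \<le>
        exp (\<bar>r y\<bar> * T) * (a y * max 0 (B (y + 1)) + b y * max 0 (B (y - 1)))"
    proof (intro always_eventually allI impI)
      fix \<sigma> assume "\<sigma> \<in> {0..s}"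
      then have \<sigma>: "0 \<le> \<sigma>" "\<sigma> \<le> T" using that by auto
      have "r y * \<sigma> \<le> \<bar>r y\<bar> * T" using \<sigma> by (intro mult_mono) auto
      then have "h y \<sigma> \<le> exp (\<bar>r y\<bar> * T) * (a y * max 0 (B (y + 1)) + b y * max 0 (B (y - 1)))"
        unfolding h_def using \<sigma> ab Gfin[OF \<sigma>]
        by (intro mult_mono add_mono) (auto intro!: add_nonneg_nonneg mult_nonneg_nonneg)
      then show "norm (h y \<sigma>) \<le> exp (\<bar>r y\<bar> * T) * (a y * max 0 (B (y + 1)) + b y * max 0 (B (y - 1)))"
        using hnn[OF \<sigma>] by simp
    qed
  qed (auto simp: emeasure_lborel_Icc_eq)
  have Geq: "G s y = exp (- (r y * s)) * (g y + integral {0..s} (h y))" if s: "0 \<le> s" "s \<le> T" for s y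
  proof -
    have "(\<integral>\<^sup>+ \<sigma>. indicator {0..s} \<sigma> * ennreal (exp (- (r y * (s - \<sigma>)))) *
        (ennreal (a y) * fk_min a b r g \<sigma> (y + 1) + ennreal (b y) * fk_min a b r g \<sigma> (y - 1)) \<partial>lborel)
      = (\<integral>\<^sup>+ \<sigma>. ennreal (exp (- (r y * s))) * ennreal (indicator {0..s} \<sigma> *\<^sub>R h y \<sigma>) \<partial>lborel)"
    proof (rule nn_integral_cong)
      fix \<sigma> :: real
      show "indicator {0..s} \<sigma> * ennreal (exp (- (r y * (s - \<sigma>)))) *
        (ennreal (a y) * fk_min a b r g \<sigma> (y + 1) + ennreal (b y) * fk_min a b r g \<sigma> (y - 1))
        = ennreal (exp (- (r y * s))) * ennreal (indicator {0..s} \<sigma> *\<^sub>R h y \<sigma>)"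
      proof (cases "\<sigma> \<in> {0..s}")
        case True
        then have \<sigma>: "0 \<le> \<sigma>" "\<sigma> \<le> T" using s by auto
        have "exp (- (r y * (s - \<sigma>))) = exp (- (r y * s)) * exp (r y * \<sigma>)"
          by (simp add: exp_add[symmetric] algebra_simps)
        then show ?thesis
          using True ab Gfin[OF \<sigma>]
          by (simp add: h_def ennreal_mult[symmetric] ennreal_plus[symmetric] mult_ac del: ennreal_plus)
      qed auto
    qed
    also have "\<dots> = ennreal (exp (- (r y * s))) * ennreal (LINT \<sigma>:{0..s}|lborel. h y \<sigma>)"
    proof (subst nn_integral_cmult)
      have "(\<integral>\<^sup>+ \<sigma>. ennreal (indicator {0..s} \<sigma> *\<^sub>R h y \<sigma>) \<partial>lborel) = ennreal (LINT \<sigma>:{0..s}|lborel. h y \<sigma>)"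
        unfolding set_lebesgue_integral_def
      proof (rule nn_integral_eq_integral)
        show "integrable lborel (\<lambda>\<sigma>. indicator {0..s} \<sigma> *\<^sub>R h y \<sigma>)"
          using hint[OF s(2)] by (simp add: set_integrable_def)
        show "AE \<sigma> in lborel. 0 \<le> indicator {0..s} \<sigma> *\<^sub>R h y \<sigma>"
          using s hnn by (intro always_eventually) (auto split: split_indicator)
      qed
      then show "ennreal (exp (- (r y * s))) * (\<integral>\<^sup>+ \<sigma>. ennreal (indicator {0..s} \<sigma> *\<^sub>R h y \<sigma>) \<partial>lborel) =
        ennreal (exp (- (r y * s))) * ennreal (LINT \<sigma>:{0..s}|lborel. h y \<sigma>)" by simp
    qed auto
    also have "(LINT \<sigma>:{0..s}|lborel. h y \<sigma>) = integral {0..s} (h y)"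
      by (rule set_borel_integral_eq_integral(2)[OF hint[OF s(2)]])
    finally have I: "(\<integral>\<^sup>+ \<sigma>. indicator {0..s} \<sigma> * ennreal (exp (- (r y * (s - \<sigma>)))) *
        (ennreal (a y) * fk_min a b r g \<sigma> (y + 1) + ennreal (b y) * fk_min a b r g \<sigma> (y - 1)) \<partial>lborel)
      = ennreal (exp (- (r y * s))) * ennreal (integral {0..s} (h y))" .
    have nn: "0 \<le> integral {0..s} (h y)"
      using hnn s by (intro integral_nonneg set_borel_integral_eq_integral(1)[OF hint]) auto
    have "fk_min a b r g s y = ennreal (exp (- (r y * s)) * (g y + integral {0..s} (h y)))"
      by (subst fk_min_renewal, subst I)
         (use nn g in \<open>simp add: ennreal_mult[symmetric] ennreal_plus[symmetric] algebra_simps del: ennreal_plus\<close>)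
    then show ?thesis using nn g[of y] by (simp add: G_def)
  qed
  have hio: "h y integrable_on {0..T}" for y
    by (rule set_borel_integral_eq_integral(1)[OF hint]) simp
  have Gcont: "continuous_on {0..T} (\<lambda>s. G s y)" for y
  proof -
    have "continuous_on {0..T} (\<lambda>s. exp (- (r y * s)) * (g y + integral {0..s} (h y)))"
      by (intro continuous_intros indefinite_integral_continuous_1 hio)
    then show ?thesis by (rule continuous_on_eq) (use Geq in auto)
  qed
  have "continuous_on {0..T} (h x)"
    unfolding h_def by (intro continuous_intros Gcont)
  then have D: "((\<lambda>s. integral {0..s} (h x)) has_real_derivative h x t) (at t within {0..T})"
    by (rule integral_has_real_derivative) (use t in auto)
  have "((\<lambda>s. exp (- (r x * s)) * (g x + integral {0..s} (h x))) has_real_derivative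
      exp (- (r x * t)) * h x t - r x * (exp (- (r x * t)) * (g x + integral {0..t} (h x)))) (at t within {0..T})"
    by (auto intro!: derivative_eq_intros D simp: algebra_simps)
  moreover have "exp (- (r x * t)) * h x t = a x * G t (x + 1) + b x * G t (x - 1)"
    by (simp add: h_def exp_minus)
  ultimately have "((\<lambda>s. exp (- (r x * s)) * (g x + integral {0..s} (h x))) has_real_derivative
      a x * G t (x + 1) + b x * G t (x - 1) - r x * G t x) (at t within {0..T})"
    using Geq[OF t] by simp
  then show ?thesis
    by (rule has_field_derivative_transform_within[OF _ zero_less_one]) (use t Geq in auto)
qed

lemma fk_min_0: "fk_min a b r g 0 x = ennreal (g x)"
proof -
  have "AE s in lborel. indicator {0..0} s * ennreal (exp (- (r x * (0 - s)))) *
        (ennreal (a x) * fk_min a b r g s (x + 1) + ennreal (b x) * fk_min a b r g s (x - 1)) = 0"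
    using AE_lborel_singleton[of "0::real"] by eventually_elim (auto split: split_indicator)
  then have "(\<integral>\<^sup>+ s. indicator {0..0} s * ennreal (exp (- (r x * (0 - s)))) *
        (ennreal (a x) * fk_min a b r g s (x + 1) + ennreal (b x) * fk_min a b r g s (x - 1)) \<partial>lborel)
      = (\<integral>\<^sup>+ s. 0 \<partial>(lborel :: real measure))"
    by (rule nn_integral_cong_AE)
  then show ?thesis by (subst fk_min_renewal) simp
qed

lemma fk_iter_cmult:
  assumes "0 \<le> c"
  shows "fk_iter a b r (\<lambda>y. c * g y) m t x = ennreal c * fk_iter a b r g m t x"
proof (induction m arbitrary: t x)
  case (Suc m)
  have "ennreal (c * g x * exp (- (r x * t))) = ennreal c * ennreal (g x * exp (- (r x * t)))"
    using assms by (simp add: ennreal_mult' mult.assoc)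
  then show ?case
    by (simp add: Suc distrib_left nn_integral_cmult[symmetric] ac_simps)
qed simp

lemma fk_min_cmult: "0 \<le> c \<Longrightarrow> fk_min a b r (\<lambda>y. c * g y) t x = ennreal c * fk_min a b r g t x"
  unfolding fk_min_def by (simp add: fk_iter_cmult SUP_mult_left_ennreal)

text \<open>
  The squared positive part is continuously differentiable, unlike the positive part itself, so it can
  serve as an energy in a comparison argument.
\<close>

lemma has_real_derivative_pos_part_squared:
  "((\<lambda>v::real. (max v 0)\<^sup>2) has_real_derivative 2 * max v 0) (at v)"
proof (cases v "0::real" rule: linorder_cases)
  case less
  have "((\<lambda>v::real. 0) has_real_derivative 2 * max v 0) (at v)" using less by simp
  then show ?thesis
    by (rule has_field_derivative_transform_within_open[where S = "{..<0}"]) (use less in auto)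
next
  case greater
  have "((\<lambda>v::real. v\<^sup>2) has_real_derivative 2 * max v 0) (at v)"
    using greater by (auto intro!: derivative_eq_intros)
  then show ?thesis
    by (rule has_field_derivative_transform_within_open[where S = "{0<..}"]) (use greater in auto)
next
  case equal
  have "((\<lambda>h::real. ((max (0 + h) 0)\<^sup>2 - (max 0 0)\<^sup>2) / h) \<longlongrightarrow> 0) (at 0)"
  proof (rule Lim_null_comparison)
    show "\<forall>\<^sub>F h in at 0. norm (((max (0 + h) 0)\<^sup>2 - (max 0 (0::real))\<^sup>2) / h) \<le> \<bar>h\<bar>"
      by (intro always_eventually allI) (auto simp: max_def power2_eq_square)
    show "((\<lambda>h::real. \<bar>h\<bar>) \<longlongrightarrow> 0) (at 0)" by (auto intro!: tendsto_eq_intros)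
  qed
  then show ?thesis using equal by (simp add: DERIV_def)
qed

text \<open>
  Subsolutions of a finite system with nonnegative off-diagonal entries that start nonpositive stay nonpositive:
  the sum E of the squared positive parts satisfies E' \<le> C E and E 0 = 0.  The off-diagonal terms
  only matter through positive parts because a and b are nonnegative.  Applied to d and -d this is uniqueness.
\<close>

lemma finite_comparison:
  fixes d d' :: "real \<Rightarrow> nat \<Rightarrow> real"
  assumes der: "\<And>s x. 0 \<le> s \<Longrightarrow> s \<le> T \<Longrightarrow> x < N \<Longrightarrow>
        ((\<lambda>s. d s x) has_real_derivative d' s x) (at s within {0..T})"
    and le: "\<And>s x. 0 \<le> s \<Longrightarrow> s \<le> T \<Longrightarrow> x < N \<Longrightarrow>
        d' s x \<le> a x * d s (x + 1) + b x * d s (x - 1) - r x * d s x"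
    and a: "\<And>x. 0 \<le> a x" and aN: "\<And>x. x < N \<Longrightarrow> N \<le> x + 1 \<Longrightarrow> a x = 0" and b: "\<And>x. 0 \<le> b x"
    and init: "\<And>x. x < N \<Longrightarrow> d 0 x \<le> 0"
    and t: "0 \<le> t" "t \<le> T" and x: "x < N"
  shows "d t x \<le> 0"
proof -
  define p where "p s y = max (d s y) 0" for s y
  define E where "E s = (\<Sum>y<N. (p s y)\<^sup>2)" for s
  define C where "C = (\<Sum>y<N. 2 * \<bar>r y\<bar> + 2 * a y + 2 * b y)"
  have pE: "(p s y)\<^sup>2 \<le> E s" if "y < N" for s y
    unfolding E_def using that by (intro member_le_sum) auto
  have derE: "(E has_real_derivative (\<Sum>y<N. 2 * p s y * d' s y)) (at s within {0..T})"
    if "0 \<le> s" "s \<le> T" for s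
    unfolding E_def p_def
    by (intro DERIV_sum DERIV_chain'[OF der has_real_derivative_pos_part_squared] that) auto
  have bound: "(\<Sum>y<N. 2 * p s y * d' s y) \<le> C * E s" if s: "0 \<le> s" "s \<le> T" for s
    unfolding C_def sum_distrib_right
  proof (rule sum_mono)
    fix y assume "y \<in> {..<N}"
    then have y: "y < N" by simp
    have two: "2 * p s y * p s z \<le> 2 * E s" if "z < N" for z
      using sum_squares_bound[of "p s y" "p s z"] pE[OF y, of s] pE[OF that, of s] by linarith
    have p0: "0 \<le> p s z" "d s z \<le> p s z" for z by (auto simp: p_def)
    have A: "2 * p s y * (a y * d s (y + 1)) \<le> a y * (2 * E s)"
    proof (cases "y + 1 < N")
      case True
      have "2 * p s y * (a y * d s (y + 1)) \<le> 2 * p s y * (a y * p s (y + 1))"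
        using a p0 by (intro mult_left_mono) auto
      also have "\<dots> = a y * (2 * p s y * p s (y + 1))" by simp
      also have "\<dots> \<le> a y * (2 * E s)" by (intro mult_left_mono two True a)
      finally show ?thesis .
    next
      case False
      then show ?thesis using aN[OF y] by simp
    qed
    have Bd: "2 * p s y * (b y * d s (y - 1)) \<le> b y * (2 * E s)"
    proof -
      have "2 * p s y * (b y * d s (y - 1)) \<le> 2 * p s y * (b y * p s (y - 1))"
        using b p0 by (intro mult_left_mono) auto
      also have "\<dots> = b y * (2 * p s y * p s (y - 1))" by simp
      also have "\<dots> \<le> b y * (2 * E s)" using y by (intro mult_left_mono two b) auto
      finally show ?thesis .
    qed
    have R: "- (2 * p s y * (r y * d s y)) \<le> 2 * \<bar>r y\<bar> * E s"
    proof -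
      have "p s y * d s y = (p s y)\<^sup>2" by (auto simp: p_def max_def power2_eq_square)
      then have "- (2 * p s y * (r y * d s y)) = 2 * (- r y) * (p s y)\<^sup>2" by (simp add: mult_ac)
      also have "\<dots> \<le> 2 * \<bar>r y\<bar> * (p s y)\<^sup>2" by (intro mult_right_mono) auto
      also have "\<dots> \<le> 2 * \<bar>r y\<bar> * E s" using pE[OF y, of s] by (intro mult_left_mono) auto
      finally show ?thesis .
    qed
    have "2 * p s y * d' s y \<le> 2 * p s y * (a y * d s (y + 1) + b y * d s (y - 1) - r y * d s y)"
      using le[OF s y] p0 by (intro mult_left_mono) auto
    also have "\<dots> \<le> (2 * \<bar>r y\<bar> + 2 * a y + 2 * b y) * E s"
      using A Bd R by (simp add: algebra_simps)
    finally show "2 * p s y * d' s y \<le> (2 * \<bar>r y\<bar> + 2 * a y + 2 * b y) * E s" .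
  qed
  \<comment> \<open>Gronwall: exp (- C s) E s is decreasing.\<close>
  have "exp (- (C * t)) * E t \<le> exp (- (C * 0)) * E 0"
  proof (rule DERIV_nonpos_imp_decreasing_open[OF t(1)])
    fix s assume s: "0 < s" "s < t"
    then have s': "0 \<le> s" "s \<le> T" using t by auto
    have "(E has_real_derivative (\<Sum>y<N. 2 * p s y * d' s y)) (at s)"
      using derE[OF s'] s t by (simp add: at_within_Icc_at)
    then have "((\<lambda>s. exp (- (C * s)) * E s) has_real_derivative
        exp (- (C * s)) * ((\<Sum>y<N. 2 * p s y * d' s y) - C * E s)) (at s)"
      by (auto intro!: derivative_eq_intros simp: algebra_simps)
    moreover have "exp (- (C * s)) * ((\<Sum>y<N. 2 * p s y * d' s y) - C * E s) \<le> 0"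
      using bound[OF s'] by (simp add: mult_le_0_iff)
    ultimately show "\<exists>y. ((\<lambda>s. exp (- (C * s)) * E s) has_real_derivative y) (at s) \<and> y \<le> 0" by blast
  next
    have "continuous_on {0..T} E"
      by (rule DERIV_continuous_on) (use derE in auto)
    then have "continuous_on {0..t} E" by (rule continuous_on_subset) (use t in auto)
    then show "continuous_on {0..t} (\<lambda>s. exp (- (C * s)) * E s)" by (intro continuous_intros)
  qed
  moreover have "E 0 = 0" using init by (auto simp: E_def p_def)
  ultimately have "E t \<le> 0" by (simp add: mult_le_0_iff)
  then have "(p t x)\<^sup>2 \<le> 0" using pE[OF x, of t] by linarith
  then have "p t x = 0" by simp
  then show ?thesis by (auto simp: p_def max_def split: if_splits)
qed

section \<open>Nonexplosion and reflection\<close>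

lemma fk_min_const_le:
  assumes "\<And>y. 0 \<le> a y" "\<And>y. 0 \<le> b y" "\<And>y. a y + b y \<le> K + r y" "\<And>y. g y \<le> B" "0 < B" "0 \<le> t"
  shows "fk_min a b r g t x \<le> ennreal (exp (K * t) * B)"
proof (rule fk_min_le_supersolution)
  fix y
  have "(a y + b y) * B \<le> (K + r y) * B" using assms(3)[of y] assms(5) by (intro mult_right_mono) auto
  then show "a y * B + b y * B \<le> (K + r y) * B" by (simp add: algebra_simps)
qed (use assms in auto)

text \<open>
  The solution F of L F = F with F 0 = 1, together with its increments D: the equation at x
  reads lam x D x - nu x D (x - 1) = F x and determines D x.  The pair is a recursion on one
  state, while F alone would look back two.
\<close>

fun eigen_pair :: "(nat \<Rightarrow> real) \<Rightarrow> (nat \<Rightarrow> real) \<Rightarrow> nat \<Rightarrow> real \<times> real" where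
  "eigen_pair lam nu 0 = (1, 1 / lam 0)"
| "eigen_pair lam nu (Suc n) =
     (case eigen_pair lam nu n of (h, d) \<Rightarrow> (h + d, (h + d + nu (Suc n) * d) / lam (Suc n)))"

locale birth_death_rates =
  fixes lam nu :: "nat \<Rightarrow> real"
  assumes lam_pos: "0 < lam x" and nu_nonneg: "0 \<le> nu x" and nu_0: "nu 0 = 0"
begin

definition eigen_fun :: "nat \<Rightarrow> real" where "eigen_fun x = fst (eigen_pair lam nu x)"
definition eigen_grad :: "nat \<Rightarrow> real" where "eigen_grad x = snd (eigen_pair lam nu x)"

lemma eigen_simps:
  "eigen_fun 0 = 1" "eigen_grad 0 = 1 / lam 0" "eigen_fun (Suc n) = eigen_fun n + eigen_grad n"
  "eigen_grad (Suc n) = (eigen_fun (Suc n) + nu (Suc n) * eigen_grad n) / lam (Suc n)"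
  by (auto simp: eigen_fun_def eigen_grad_def split: prod.splits)

lemma eigen_fun_ge_1: "1 \<le> eigen_fun n \<and> 0 \<le> eigen_grad n"
proof (induction n)
  case (Suc n)
  then show ?case using lam_pos[of "Suc n"] nu_nonneg[of "Suc n"] by (auto simp: eigen_simps)
qed (use lam_pos[of 0] in \<open>auto simp: eigen_simps\<close>)

lemma generator_eigen_fun: "lam x * (eigen_fun (x + 1) - eigen_fun x) + nu x * (eigen_fun (x - 1) - eigen_fun x) = eigen_fun x"
  using lam_pos[of x] by (cases x) (auto simp: eigen_simps nu_0 field_simps)

text \<open>
  The summand of Feller's series.  It solves the recursion of the increments of F with the right-hand side F x replaced by
  1, hence is at most the increment of F, because F \<ge> 1.
\<close>

definition feller_term :: "nat \<Rightarrow> real" where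
  "feller_term x = (\<Sum>k\<le>x. (\<Prod>j\<in>{k<..x}. nu j) / (\<Prod>j\<in>{k..x}. lam j))"

lemma feller_term_Suc: "feller_term (Suc n) = (1 + nu (Suc n) * feller_term n) / lam (Suc n)"
proof -
  have "(\<Prod>j\<in>{k<..Suc n}. nu j) / (\<Prod>j\<in>{k..Suc n}. lam j)
      = nu (Suc n) / lam (Suc n) * ((\<Prod>j\<in>{k<..n}. nu j) / (\<Prod>j\<in>{k..n}. lam j))" if "k \<le> n" for k
  proof -
    have "{k<..Suc n} = insert (Suc n) {k<..n}" "{k..Suc n} = insert (Suc n) {k..n}" using that by auto
    then show ?thesis by simp
  qed
  then have "(\<Sum>k\<le>n. (\<Prod>j\<in>{k<..Suc n}. nu j) / (\<Prod>j\<in>{k..Suc n}. lam j)) = nu (Suc n) / lam (Suc n) * feller_term n"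
    unfolding feller_term_def sum_distrib_left by (intro sum.cong) auto
  then show ?thesis unfolding feller_term_def[of "Suc n"] by (simp add: add_divide_distrib)
qed

lemma feller_term_le_eigen_grad: "0 \<le> feller_term n \<and> feller_term n \<le> eigen_grad n"
proof (induction n)
  case 0
  then show ?case using lam_pos[of 0] by (simp add: feller_term_def eigen_simps)
next
  case (Suc n)
  have "nu (Suc n) * feller_term n \<le> nu (Suc n) * eigen_grad n"
    using Suc nu_nonneg[of "Suc n"] by (intro mult_left_mono) auto
  then have "1 + nu (Suc n) * feller_term n \<le> eigen_fun (Suc n) + nu (Suc n) * eigen_grad n"
    using eigen_fun_ge_1[of "Suc n"] by linarith
  moreover have "0 \<le> 1 + nu (Suc n) * feller_term n" using Suc nu_nonneg[of "Suc n"] by simp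
  ultimately show ?case
    using lam_pos[of "Suc n"] by (simp add: feller_term_Suc eigen_simps(4) divide_right_mono)
qed

lemma incseq_eigen_fun: "incseq eigen_fun"
  using eigen_fun_ge_1 by (intro incseq_SucI) (simp add: eigen_simps)

lemma eigen_fun_sum: "eigen_fun (Suc n) = eigen_fun 1 + (\<Sum>i<n. eigen_grad (Suc i))"
  by (induction n) (auto simp: eigen_simps)

text \<open>
  A bounded F would have summable increments, and these dominate the terms of Feller's series.
\<close>

lemma eigen_fun_at_top:
  assumes "bd_nonexplosive lam nu"
  shows "filterlim eigen_fun at_top sequentially"
proof -
  have ex: "\<exists>n. B \<le> eigen_fun n" for B
  proof (rule ccontr)
    assume "\<not> (\<exists>n. B \<le> eigen_fun n)"
    then have lt: "eigen_fun n < B" for n by (simp add: not_le)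
    have "summable (\<lambda>n. feller_term (Suc n))"
    proof (rule summableI_nonneg_bounded)
      show "0 \<le> feller_term (Suc n)" for n using feller_term_le_eigen_grad by blast
      show "(\<Sum>i<n. feller_term (Suc i)) \<le> B" for n
      proof -
        have "(\<Sum>i<n. feller_term (Suc i)) \<le> (\<Sum>i<n. eigen_grad (Suc i))"
          using feller_term_le_eigen_grad by (intro sum_mono) blast
        then show ?thesis using lt[of "Suc n"] eigen_fun_ge_1[of 1] unfolding eigen_fun_sum by linarith
      qed
    qed
    then show False using assms by (simp add: bd_nonexplosive_def feller_term_def Let_def)
  qed
  then show ?thesis
    unfolding filterlim_at_top eventually_sequentially
  proof (intro allI)
    fix B
    obtain N where "B \<le> eigen_fun N" using ex by blast
    then show "\<exists>N. \<forall>n\<ge>N. B \<le> eigen_fun n"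
      using incseqD[OF incseq_eigen_fun, of N] by (intro exI[of _ N] allI impI) (rule order_trans)
  qed
qed

text \<open>
  With births suppressed at N, there are two natural diagonals: lam + nu kills the process when it
  attempts to leave {0, ..., N}, and the reduced rates plus nu reflect it at N.
\<close>

definition lamN :: "nat \<Rightarrow> nat \<Rightarrow> real" where "lamN N x = (if x < N then lam x else 0)"

lemma lamN_nonneg: "0 \<le> lamN N x" using lam_pos[of x] by (simp add: lamN_def)

abbreviation sem :: "(nat \<Rightarrow> real) \<Rightarrow> real \<Rightarrow> nat \<Rightarrow> ennreal" where
  "sem f \<equiv> fk_min lam nu (\<lambda>y. lam y + nu y) f"
abbreviation killed :: "nat \<Rightarrow> (nat \<Rightarrow> real) \<Rightarrow> real \<Rightarrow> nat \<Rightarrow> ennreal" where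
  "killed N f \<equiv> fk_min (lamN N) nu (\<lambda>y. lam y + nu y) f"
abbreviation reflected :: "nat \<Rightarrow> (nat \<Rightarrow> real) \<Rightarrow> real \<Rightarrow> nat \<Rightarrow> ennreal" where
  "reflected N f \<equiv> fk_min (lamN N) nu (\<lambda>y. lamN N y + nu y) f"

lemma lamN_le: "lamN N y \<le> lam y" using lam_pos[of y] by (simp add: lamN_def)

lemma sem_le: "0 < B \<Longrightarrow> (\<And>y. f y \<le> B) \<Longrightarrow> 0 \<le> t \<Longrightarrow> sem f t x \<le> ennreal B"
  using fk_min_const_le[of lam nu 0 "\<lambda>y. lam y + nu y" f B t x] lam_pos nu_nonneg
  by (simp add: less_imp_le)

lemma killed_le: "0 < B \<Longrightarrow> (\<And>y. f y \<le> B) \<Longrightarrow> 0 \<le> t \<Longrightarrow> killed N f t x \<le> ennreal B"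
  using fk_min_const_le[of "lamN N" nu 0 "\<lambda>y. lam y + nu y" f B t x] lamN_nonneg lamN_le nu_nonneg
  by (simp add: less_imp_le)

lemma reflected_le: "0 < B \<Longrightarrow> (\<And>y. f y \<le> B) \<Longrightarrow> 0 \<le> t \<Longrightarrow> reflected N f t x \<le> ennreal B"
  using fk_min_const_le[of "lamN N" nu 0 "\<lambda>y. lamN N y + nu y" f B t x] lamN_nonneg nu_nonneg
  by (simp add: less_imp_le)

lemma killed_tendsto_sem:
  assumes "\<And>y. 0 \<le> f y" "0 \<le> t"
  shows "(\<lambda>N. killed (Suc N) f t x) \<longlonglongrightarrow> sem f t x"
  by (rule fk_min_tendsto_of_local_agreement) (use assms lamN_le in \<open>auto simp: lamN_def\<close>)

text \<open>
  The function 1 - exp t F x / F (N + 1) solves the backward equation, is at most 1 at time 0, and is nonpositive at N + 1.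
  By comparison it lies below the mass that survives the killing.
  In probabilistic terms, exp (- t) F(X_t) is a martingale up to the exit time, which bounds the exit probability.
\<close>

lemma killed_mass_ge:
  assumes "0 \<le> t" "x \<le> N"
  shows "1 - exp t * eigen_fun x / eigen_fun (Suc N) \<le> enn2real (killed N (\<lambda>_. 1) t x)"
proof -
  define k where "k s y = enn2real (killed N (\<lambda>_. 1) s y)" for s y
  define z where "z s y = 1 - exp s * eigen_fun y / eigen_fun (Suc N)" for s y
  define d' where "d' s y = - (exp s * eigen_fun y / eigen_fun (Suc N)) -
     (lamN N y * k s (y + 1) + nu y * k s (y - 1) - (lam y + nu y) * k s y)" for s y
  have hN: "0 < eigen_fun (Suc N)" using eigen_fun_ge_1[of "Suc N"] by linarith
  have "z t x - k t x \<le> 0"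
  proof (rule finite_comparison[where T = t and N = "Suc N" and d = "\<lambda>s y. z s y - k s y" and d' = d'
        and a = "lamN N" and b = nu and r = "\<lambda>y. lam y + nu y"])
    fix s y assume s: "0 \<le> s" "s \<le> t" and y: "y < Suc N"
    have "((\<lambda>s. k s y) has_real_derivative
       lamN N y * k s (y + 1) + nu y * k s (y - 1) - (lam y + nu y) * k s y) (at s within {0..t})"
      unfolding k_def
      by (rule fk_min_has_real_derivative[where B = "\<lambda>_. 1"])
         (use s lamN_nonneg nu_nonneg in \<open>auto intro: killed_le[of 1, simplified]\<close>)
    moreover have "((\<lambda>s. z s y) has_real_derivative - (exp s * eigen_fun y / eigen_fun (Suc N))) (at s within {0..t})"
      unfolding z_def using hN by (auto intro!: derivative_eq_intros)
    ultimately show "((\<lambda>s. z s y - k s y) has_real_derivative d' s y) (at s within {0..t})"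
      unfolding d'_def by (rule DERIV_diff[rotated])
    have "- (exp s * eigen_fun y / eigen_fun (Suc N)) \<le> lamN N y * z s (y + 1) + nu y * z s (y - 1) - (lam y + nu y) * z s y"
    proof -
      define q where "q = exp s / eigen_fun (Suc N)"
      have zq: "z s w = 1 - q * eigen_fun w" for w by (simp add: z_def q_def)
      have "lam y * z s (y + 1) + nu y * z s (y - 1) - (lam y + nu y) * z s y
          = - q * (lam y * (eigen_fun (y + 1) - eigen_fun y) + nu y * (eigen_fun (y - 1) - eigen_fun y))"
        unfolding zq by (simp add: algebra_simps)
      also have "\<dots> = - q * eigen_fun y" unfolding generator_eigen_fun ..
      finally have e: "lam y * z s (y + 1) + nu y * z s (y - 1) - (lam y + nu y) * z s y = - q * eigen_fun y" .
      have "lam y * z s (y + 1) \<le> lamN N y * z s (y + 1)"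
      proof (cases "y < N")
        case False
        then have "y = N" using y by simp
        then have "z s (y + 1) \<le> 0" using hN s by (simp add: z_def)
        then show ?thesis using False lam_pos[of y] by (simp add: lamN_def mult_le_0_iff)
      qed (simp add: lamN_def)
      then show ?thesis using e by (simp add: q_def)
    qed
    then show "d' s y \<le> lamN N y * (z s (y + 1) - k s (y + 1)) + nu y * (z s (y - 1) - k s (y - 1))
        - (lam y + nu y) * (z s y - k s y)"
      unfolding d'_def by (simp add: algebra_simps)
  next
    fix y assume "y < Suc N"
    show "z 0 y - k 0 y \<le> 0"
      using hN eigen_fun_ge_1[of y] by (simp add: z_def k_def fk_min_0)
  qed (use assms lamN_nonneg nu_nonneg in \<open>auto simp: lamN_def\<close>)
  then show ?thesis by (simp add: z_def k_def)
qed

lemma sem_one_of_nonexplosive: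
  assumes "bd_nonexplosive lam nu" "0 \<le> t"
  shows "sem (\<lambda>_. 1) t x = 1"
proof (rule antisym)
  show "sem (\<lambda>_. 1) t x \<le> 1" using sem_le[of 1 "\<lambda>_. 1" t x] assms by simp
  have fin: "sem (\<lambda>_. 1) t x < \<top>" using sem_le[of 1 "\<lambda>_. 1" t x] assms
    by (auto intro: le_less_trans)
  have "(\<lambda>N. 1 - exp t * eigen_fun x / eigen_fun (Suc N)) \<longlonglongrightarrow> 1 - 0"
    by (intro tendsto_diff tendsto_const real_tendsto_divide_at_top[OF tendsto_const]
        filterlim_compose[OF eigen_fun_at_top[OF assms(1)] filterlim_Suc])
  moreover have "\<forall>\<^sub>F N in sequentially. 1 - exp t * eigen_fun x / eigen_fun (Suc N) \<le> enn2real (sem (\<lambda>_. 1) t x)"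
  proof (rule eventually_sequentiallyI[of x])
    fix N assume "x \<le> N"
    have "killed N (\<lambda>_. 1) t x \<le> sem (\<lambda>_. 1) t x"
      by (rule fk_min_mono) (use lamN_le assms in auto)
    then have "enn2real (killed N (\<lambda>_. 1) t x) \<le> enn2real (sem (\<lambda>_. 1) t x)"
      using fin by (rule enn2real_mono)
    then show "1 - exp t * eigen_fun x / eigen_fun (Suc N) \<le> enn2real (sem (\<lambda>_. 1) t x)"
      using killed_mass_ge[OF assms(2) \<open>x \<le> N\<close>] by linarith
  qed
  ultimately have "1 - 0 \<le> enn2real (sem (\<lambda>_. 1) t x)"
    by (rule tendsto_upperbound) simp
  then show "1 \<le> sem (\<lambda>_. 1) t x"
    using ennreal_leI[of 1 "enn2real (sem (\<lambda>_. 1) t x)"] fin by simp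
qed

text \<open>
  The reflected semigroup exceeds the killed one, and for 0 \<le> f \<le> B the excess is at most B times the mass
  lost by killing: apply the domination to B - f as well and use that the reflected semigroup does not
  exceed B on the constant B.
\<close>

lemma reflected_tendsto_sem:
  assumes ne: "bd_nonexplosive lam nu" and t: "0 \<le> t" and f: "\<And>y. 0 \<le> f y" "\<And>y. f y \<le> B"
  shows "(\<lambda>N. enn2real (reflected (Suc N) f t x)) \<longlonglongrightarrow> enn2real (sem f t x)"
proof -
  \<comment> \<open>The bounds for constants are stated for positive ones, and B may be 0.\<close>
  define B' where "B' = max B 1"
  have B': "0 < B'" "0 \<le> B'" "\<And>y. f y \<le> B'" using f by (auto simp: B'_def intro: le_max_iff_disj[THEN iffD2])
  have fin: "sem g t x < \<top>" "reflected N g t x < \<top>" "killed N g t x < \<top>" if "\<And>y. g y \<le> B'" for g N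
    using sem_le[of B' g t x] reflected_le[of B' g t N x] killed_le[of B' g t N x] B' that t
    by (auto intro: le_less_trans)
  have lim: "(\<lambda>N. enn2real (killed (Suc N) g t x)) \<longlonglongrightarrow> enn2real (sem g t x)"
    if "\<And>y. 0 \<le> g y" "\<And>y. g y \<le> B'" for g
  proof (rule tendsto_enn2real)
    have "ennreal (enn2real (sem g t x)) = sem g t x"
      by (rule ennreal_enn2real[OF fin(1)[OF that(2)]])
    then show "(\<lambda>N. killed (Suc N) g t x) \<longlonglongrightarrow> ennreal (enn2real (sem g t x))"
      by (subst \<open>ennreal (enn2real (sem g t x)) = sem g t x\<close>) (rule killed_tendsto_sem[OF that(1) t])
  qed simp
  have upper: "enn2real (reflected N f t x) \<le> B' * (1 - enn2real (killed N (\<lambda>_. 1) t x)) + enn2real (killed N f t x)" for N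
  proof -
    define g where "g y = B' - f y" for y
    have g: "0 \<le> g y" "g y \<le> B'" for y using f B' by (auto simp: g_def)
    have s: "(\<lambda>y. f y + g y) = (\<lambda>y. B' * 1)" by (simp add: g_def)
    have "reflected N f t x + reflected N g t x = reflected N (\<lambda>y. f y + g y) t x"
      by (rule fk_min_add[symmetric]) (use f g in auto)
    also have "\<dots> \<le> ennreal B'" using reflected_le[of B' "\<lambda>y. f y + g y" t N x] B' t by (simp add: g_def)
    finally have R: "enn2real (reflected N f t x) + enn2real (reflected N g t x) \<le> B'"
      using fin(2)[of f N] fin(2)[of g N] B' g(2)
      by (subst enn2real_plus[symmetric]) (auto intro: enn2real_leI)
    have "killed N f t x + killed N g t x = killed N (\<lambda>y. f y + g y) t x"
      by (rule fk_min_add[symmetric]) (use f g in auto)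
    also have "\<dots> = ennreal B' * killed N (\<lambda>_. 1) t x" unfolding s by (rule fk_min_cmult) (rule B')
    finally have K: "enn2real (killed N f t x) + enn2real (killed N g t x) = B' * enn2real (killed N (\<lambda>_. 1) t x)"
      using fin(3)[of f N] fin(3)[of g N] B' g(2)
      by (subst enn2real_plus[symmetric]) (auto simp: enn2real_mult)
    have "killed N g t x \<le> reflected N g t x"
      by (rule fk_min_mono) (use lamN_le g t in auto)
    then have "enn2real (killed N g t x) \<le> enn2real (reflected N g t x)"
      using fin(2)[of g N] g(2) by (intro enn2real_mono) auto
    then show ?thesis using R K by (simp add: algebra_simps)
  qed
  have lower: "enn2real (killed N f t x) \<le> enn2real (reflected N f t x)" for N
    by (intro enn2real_mono fk_min_mono) (use lamN_le t f B' fin(2)[of f N] in auto)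
  have "(\<lambda>N. B' * (1 - enn2real (killed (Suc N) (\<lambda>_. 1) t x)) + enn2real (killed (Suc N) f t x))
      \<longlonglongrightarrow> B' * (1 - enn2real (sem (\<lambda>_. 1) t x)) + enn2real (sem f t x)"
    by (intro tendsto_add tendsto_mult tendsto_diff tendsto_const lim f B') (auto simp: B'_def)
  then have "(\<lambda>N. B' * (1 - enn2real (killed (Suc N) (\<lambda>_. 1) t x)) + enn2real (killed (Suc N) f t x))
      \<longlonglongrightarrow> enn2real (sem f t x)"
    by (simp add: sem_one_of_nonexplosive[OF ne t])
  from tendsto_sandwich[OF _ _ lim[OF f(1) B'(3)] this] show ?thesis
    using lower upper by simp
qed

end

section \<open>The finite and the infinite intertwining\<close>

text \<open>
  Writing the lower bound of the potential as -K makes exp (K t) the growth bound of the Feynman--Kac semigroup.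
\<close>

locale modified_rates = birth_death_rates lam nu for lam nu :: "nat \<Rightarrow> real" +
  fixes u :: "nat \<Rightarrow> real" and K :: real
  assumes u_pos: "0 < u x"
    and potential_ge: "- K \<le> potential u lam nu x"
    and nonexplosive: "bd_nonexplosive lam nu"
begin

text \<open>
  The diagonal nu (x + 1) + lam x is the total jump rate of the u-modification plus its potential, so no division by u is left in it.
\<close>

abbreviation usem :: "(nat \<Rightarrow> real) \<Rightarrow> real \<Rightarrow> nat \<Rightarrow> ennreal" where
  "usem g \<equiv> fk_min (mod_birth u lam) (mod_death u nu) (\<lambda>y. nu (y + 1) + lam y) g"

text \<open>
  The A-system killed outside {0, ..., N - 1}: births at N - 1 are suppressed and the diagonal is kept.
\<close>

definition mod_birthN :: "nat \<Rightarrow> nat \<Rightarrow> real" where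
  "mod_birthN N x = (if x + 1 < N then mod_birth u lam x else 0)"

abbreviation usemN :: "nat \<Rightarrow> (nat \<Rightarrow> real) \<Rightarrow> real \<Rightarrow> nat \<Rightarrow> ennreal" where
  "usemN N g \<equiv> fk_min (mod_birthN N) (mod_death u nu) (\<lambda>y. nu (y + 1) + lam y) g"

lemma mod_birth_pos: "0 < mod_birth u lam x"
  using u_pos lam_pos by (simp add: mod_birth_def)
lemma mod_death_nonneg: "0 \<le> mod_death u nu x"
  using u_pos[of x] u_pos[of "x - 1"] nu_nonneg[of x] by (simp add: mod_death_def)
lemma mod_birthN_bounds: "0 \<le> mod_birthN N x" "mod_birthN N x \<le> mod_birth u lam x"
  using mod_birth_pos[of x] by (auto simp: mod_birthN_def)

text \<open>
  Constants are supersolutions: the total jump rate minus the diagonal is minus the potential, hence at most K.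
\<close>

lemma usem_le:
  assumes "0 < C" "\<And>y. g y \<le> C" "0 \<le> t"
  shows "usem g t x \<le> ennreal (exp (K * t) * C)" "usemN N g t x \<le> ennreal (exp (K * t) * C)"
proof -
  have "mod_birth u lam y + mod_death u nu y \<le> K + (nu (y + 1) + lam y)" for y
    using potential_ge[of y] by (simp add: potential_def)
  then have le: "mod_birth u lam y + mod_death u nu y \<le> K + (nu (y + 1) + lam y)"
    "mod_birthN N y + mod_death u nu y \<le> K + (nu (y + 1) + lam y)" for y
    using mod_birthN_bounds(2)[of N y] by (auto intro: order_trans[OF add_right_mono])
  show "usem g t x \<le> ennreal (exp (K * t) * C)" "usemN N g t x \<le> ennreal (exp (K * t) * C)"
    by (rule fk_min_const_le;
        use assms le mod_birth_pos[THEN less_imp_le] mod_birthN_bounds(1) mod_death_nonneg in blast)+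
qed

lemma usemN_tendsto_usem:
  assumes "\<And>y. 0 \<le> g y" "0 \<le> t"
  shows "(\<lambda>N. usemN (N + 2) g t x) \<longlonglongrightarrow> usem g t x"
  by (rule fk_min_tendsto_of_local_agreement) (use assms mod_birthN_bounds mod_birth_pos in \<open>auto simp: mod_birthN_def less_imp_le\<close>)

text \<open>
  The difference d of both sides satisfies, on {0, ..., N - 1}, the linear equation with matrix u A (1/u),
  whose rates are lam (x + 1), nu x and diagonal nu (x + 1) + lam x, and vanishes at time 0.
  The suppressed birth rate of the reflected process at N closes the system at N - 1.
\<close>

lemma finite_intertwining:
  assumes f: "\<And>y. 0 \<le> f y" "\<And>y. f y \<le> B" and g: "\<And>y. 0 \<le> u_grad u f y" "\<And>y. u_grad u f y \<le> C"
    and t: "0 \<le> t" and x: "x < N"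
  shows "enn2real (reflected N f t (x + 1)) - enn2real (reflected N f t x) =
    u x * enn2real (usemN N (u_grad u f) t x)"
proof -
  define R where "R s y = enn2real (reflected N f s y)" for s y
  define D where "D s y = enn2real (usemN N (u_grad u f) s y)" for s y
  define d where "d s y = R s (y + 1) - R s y - u y * D s y" for s y
  define d' where "d' s y = lamN N (y + 1) * d s (y + 1) + nu y * d s (y - 1) - (nu (y + 1) + lam y) * d s y" for s y
  have "((\<lambda>s. d s y) has_real_derivative d' s y) (at s within {0..t})"
    if s: "0 \<le> s" "s \<le> t" and y: "y < N" for s y
  proof -
    have R': "((\<lambda>s. R s z) has_real_derivative
       lamN N z * R s (z + 1) + nu z * R s (z - 1) - (lamN N z + nu z) * R s z) (at s within {0..t})" for z
      unfolding R_def
    proof (rule fk_min_has_real_derivative[where B = "\<lambda>_. max B 1"])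
      show "reflected N f s y \<le> ennreal (max B 1)" if "0 \<le> s" for s y
        using that f by (intro reflected_le) (auto intro: le_max_iff_disj[THEN iffD2])
    qed (use s f lamN_nonneg nu_nonneg in auto)
    have D': "((\<lambda>s. D s y) has_real_derivative
       mod_birthN N y * D s (y + 1) + mod_death u nu y * D s (y - 1) - (nu (y + 1) + lam y) * D s y)
       (at s within {0..t})"
      unfolding D_def
    proof (rule fk_min_has_real_derivative[where B = "\<lambda>_. exp (\<bar>K\<bar> * t) * max C 1"])
      fix s y assume s: "0 \<le> s" "s \<le> t"
      have "usemN N (u_grad u f) s y \<le> ennreal (exp (K * s) * max C 1)"
        using s g by (intro usem_le) (auto intro: le_max_iff_disj[THEN iffD2])
      also have "\<dots> \<le> ennreal (exp (\<bar>K\<bar> * t) * max C 1)"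
        using s by (intro ennreal_leI mult_right_mono) (auto intro: mult_mono)
      finally show "usemN N (u_grad u f) s y \<le> ennreal (exp (\<bar>K\<bar> * t) * max C 1)" .
    qed (use s g mod_birthN_bounds mod_death_nonneg in auto)
    have "((\<lambda>s. d s y) has_real_derivative
       (lamN N (y + 1) * R s (y + 1 + 1) + nu (y + 1) * R s (y + 1 - 1) - (lamN N (y + 1) + nu (y + 1)) * R s (y + 1))
       - (lamN N y * R s (y + 1) + nu y * R s (y - 1) - (lamN N y + nu y) * R s y)
       - u y * (mod_birthN N y * D s (y + 1) + mod_death u nu y * D s (y - 1) - (nu (y + 1) + lam y) * D s y))
       (at s within {0..t})"
      unfolding d_def by (intro DERIV_diff DERIV_cmult R' D')
    also have "(lamN N (y + 1) * R s (y + 1 + 1) + nu (y + 1) * R s (y + 1 - 1) - (lamN N (y + 1) + nu (y + 1)) * R s (y + 1))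
       - (lamN N y * R s (y + 1) + nu y * R s (y - 1) - (lamN N y + nu y) * R s y)
       - u y * (mod_birthN N y * D s (y + 1) + mod_death u nu y * D s (y - 1) - (nu (y + 1) + lam y) * D s y)
       = d' s y"
    proof -
      have "u y * mod_birthN N y = lamN N (y + 1) * u (y + 1)"
        using u_pos[of y] by (simp add: mod_birthN_def mod_birth_def lamN_def)
      then have 1: "u y * (mod_birthN N y * D s (y + 1)) = lamN N (y + 1) * (u (y + 1) * D s (y + 1))"
        by (metis mult.assoc)
      have "u y * mod_death u nu y = nu y * u (y - 1)"
        using u_pos[of y] by (simp add: mod_death_def)
      then have 2: "u y * (mod_death u nu y * D s (y - 1)) = nu y * (u (y - 1) * D s (y - 1))"
        by (metis mult.assoc)
      \<comment> \<open>At y = 0 the truncated difference is multiplied by nu 0 = 0.\<close>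
      have 3: "nu y * d s (y - 1) = nu y * (R s y - R s (y - 1) - u (y - 1) * D s (y - 1))"
        by (cases y) (auto simp: d_def nu_0)
      have 4: "lamN N y = lam y" using y by (simp add: lamN_def)
      have 5: "u y * (mod_birthN N y * D s (y + 1) + mod_death u nu y * D s (y - 1) - (nu (y + 1) + lam y) * D s y)
        = lamN N (y + 1) * (u (y + 1) * D s (y + 1)) + nu y * (u (y - 1) * D s (y - 1)) - (nu (y + 1) + lam y) * (u y * D s y)"
        unfolding distrib_left right_diff_distrib 1 2 by (simp add: algebra_simps)
      show ?thesis
        unfolding d'_def 3 5 4 d_def[of s y] d_def[of s "y + 1"]
        by (simp add: algebra_simps)
    qed
    finally show ?thesis .
  qed
  note der = this
  have d0: "d 0 y = 0" for y
    using f g u_pos[of y] by (simp add: d_def R_def D_def fk_min_0 u_grad_def fwd_diff_def)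
  have "d t x \<le> 0"
    by (rule finite_comparison[where T = t and N = N and d' = d' and a = "\<lambda>y. lamN N (y + 1)" and b = nu
          and r = "\<lambda>y. nu (y + 1) + lam y"])
       (use der d0 t x lamN_nonneg nu_nonneg in \<open>auto simp: d'_def lamN_def\<close>)
  moreover have "- d t x \<le> 0"
  proof (rule finite_comparison[where T = t and N = N and d = "\<lambda>s y. - d s y" and d' = "\<lambda>s y. - d' s y"
          and a = "\<lambda>y. lamN N (y + 1)" and b = nu and r = "\<lambda>y. nu (y + 1) + lam y"])
    show "((\<lambda>s. - d s y) has_real_derivative - d' s y) (at s within {0..t})"
      if "0 \<le> s" "s \<le> t" "y < N" for s y
      by (intro DERIV_minus der that)
  qed (use d0 t x lamN_nonneg nu_nonneg in \<open>auto simp: d'_def lamN_def\<close>)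
  ultimately show ?thesis by (simp add: d_def R_def D_def)
qed

text \<open>
  Both sides of the finite identity converge.  With the truncation at N + 2 all rates on {0, ..., N} are exact.
\<close>

lemma bounded_intertwining:
  assumes f: "\<And>y. 0 \<le> f y" "\<And>y. f y \<le> B" and g: "\<And>y. 0 \<le> u_grad u f y" "\<And>y. u_grad u f y \<le> C"
    and t: "0 \<le> t"
  shows "enn2real (sem f t (x + 1)) - enn2real (sem f t x) = u x * enn2real (usem (u_grad u f) t x)"
proof (rule LIMSEQ_unique)
  have "(\<lambda>N. enn2real (reflected (Suc (N + 1)) f t y)) \<longlonglongrightarrow> enn2real (sem f t y)" for y
    by (rule LIMSEQ_ignore_initial_segment[OF reflected_tendsto_sem[OF nonexplosive t f]])
  then have R: "(\<lambda>N. enn2real (reflected (N + 2) f t y)) \<longlonglongrightarrow> enn2real (sem f t y)" for y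
    by simp
  show "(\<lambda>N. enn2real (reflected (N + 2) f t (x + 1)) - enn2real (reflected (N + 2) f t x))
      \<longlonglongrightarrow> enn2real (sem f t (x + 1)) - enn2real (sem f t x)"
    by (intro tendsto_diff R)
  have "usem (u_grad u f) t x \<le> ennreal (exp (K * t) * max C 1)"
    using t g by (intro usem_le) (auto intro: le_max_iff_disj[THEN iffD2])
  then have fin: "usem (u_grad u f) t x < \<top>"
    by (rule le_less_trans) simp
  have "(\<lambda>N. u x * enn2real (usemN (N + 2) (u_grad u f) t x)) \<longlonglongrightarrow> u x * enn2real (usem (u_grad u f) t x)"
    by (intro tendsto_mult tendsto_const tendsto_enn2real)
       (use usemN_tendsto_usem[of "u_grad u f" t x] g t fin in \<open>simp_all add: less_top\<close>)
  then show "(\<lambda>N. enn2real (reflected (N + 2) f t (x + 1)) - enn2real (reflected (N + 2) f t x))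
      \<longlonglongrightarrow> u x * enn2real (usem (u_grad u f) t x)"
  proof (rule Lim_transform_eventually)
    show "\<forall>\<^sub>F N in sequentially. u x * enn2real (usemN (N + 2) (u_grad u f) t x) =
        enn2real (reflected (N + 2) f t (x + 1)) - enn2real (reflected (N + 2) f t x)"
      by (rule eventually_sequentiallyI[of x], rule finite_intertwining[symmetric])
         (use f g t in auto)
  qed
qed

text \<open>
  The point of this bound is that it does not involve B.  At the state 0 the generator is lam 0 times a difference,
  so by the intertwining the time derivative of the semigroup at 0 is controlled by the gradient bound C.
\<close>

lemma sem_at_0_le:
  assumes f: "\<And>y. 0 \<le> f y" "\<And>y. f y \<le> B" and g: "\<And>y. 0 \<le> u_grad u f y" "\<And>y. u_grad u f y \<le> C"
    and C: "0 < C" and t: "0 \<le> t"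
  shows "sem f t 0 \<le> ennreal (f 0 + lam 0 * u 0 * (exp (\<bar>K\<bar> * t) * C) * t)"
proof -
  define G where "G s y = enn2real (sem f s y)" for s y
  define M where "M = lam 0 * u 0 * (exp (\<bar>K\<bar> * t) * C)"
  have bnd: "sem f s y \<le> ennreal (max B 1)" if "0 \<le> s" for s y
    using that f by (intro sem_le) (auto intro: le_max_iff_disj[THEN iffD2])
  have der: "((\<lambda>s. G s 0) has_real_derivative lam 0 * (G s 1 - G s 0)) (at s within {0..t})"
    if s: "0 \<le> s" "s \<le> t" for s
  proof -
    have "((\<lambda>s. G s 0) has_real_derivative
       lam 0 * G s (0 + 1) + nu 0 * G s (0 - 1) - (lam 0 + nu 0) * G s 0) (at s within {0..t})"
      unfolding G_def
      by (rule fk_min_has_real_derivative[where B = "\<lambda>_. max B 1"])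
         (use s f bnd lam_pos nu_nonneg in \<open>auto simp: less_imp_le\<close>)
    then show ?thesis by (simp add: nu_0 algebra_simps)
  qed
  have le: "lam 0 * (G s 1 - G s 0) \<le> M" if s: "0 \<le> s" "s \<le> t" for s
  proof -
    have "usem (u_grad u f) s 0 \<le> ennreal (exp (K * s) * C)" using s g C by (intro usem_le)
    also have "\<dots> \<le> ennreal (exp (\<bar>K\<bar> * t) * C)"
      using s C by (intro ennreal_leI mult_right_mono) (auto intro: mult_mono)
    finally have "enn2real (usem (u_grad u f) s 0) \<le> exp (\<bar>K\<bar> * t) * C"
      using C by (intro enn2real_leI) auto
    moreover have "G s 1 - G s 0 = u 0 * enn2real (usem (u_grad u f) s 0)"
      using bounded_intertwining[OF f g s(1), of 0] by (simp add: G_def)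
    ultimately show ?thesis using lam_pos[of 0] u_pos[of 0] by (simp add: M_def mult.assoc)
  qed
  have "G t 0 - M * t \<le> G 0 0 - M * 0"
  proof (rule DERIV_nonpos_imp_decreasing_open[OF t])
    fix s assume s: "0 < s" "s < t"
    have "((\<lambda>s. G s 0) has_real_derivative lam 0 * (G s 1 - G s 0)) (at s)"
      using der[of s] s by (simp add: at_within_Icc_at)
    then have "((\<lambda>s. G s 0 - M * s) has_real_derivative lam 0 * (G s 1 - G s 0) - M) (at s)"
      by (auto intro!: derivative_eq_intros)
    then show "\<exists>y. ((\<lambda>s. G s 0 - M * s) has_real_derivative y) (at s) \<and> y \<le> 0"
      using le[of s] s by fastforce
  next
    have "continuous_on {0..t} (\<lambda>s. G s 0)"
      by (rule DERIV_continuous_on) (use der in auto)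
    then show "continuous_on {0..t} (\<lambda>s. G s 0 - M * s)" by (intro continuous_intros)
  qed
  then have "G t 0 \<le> f 0 + M * t" using f by (simp add: G_def fk_min_0)
  moreover have "sem f t 0 = ennreal (G t 0)"
    using le_less_trans[OF bnd[OF t, of 0] ennreal_less_top] unfolding G_def by simp
  ultimately show ?thesis by (simp add: M_def ennreal_leI)
qed

text \<open>
  The gradient of f stopped at level k is that of f below k and 0 above, so both sides converge as
  k grows.  The limits are finite at 0 by the previous bound, and then at all states by the
  identity itself.
\<close>

theorem increasing_intertwining:
  assumes f: "f 0 = 0" and g: "\<And>y. 0 \<le> u_grad u f y" "\<And>y. u_grad u f y \<le> C" and t: "0 \<le> t"
  shows "sem f t x < \<top>"
    and "enn2real (sem f t (x + 1)) - enn2real (sem f t x) = u x * enn2real (usem (u_grad u f) t x)"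
proof -
  define C' where "C' = max C 1"
  have C': "0 < C'" "\<And>y. u_grad u f y \<le> C'" using g by (auto simp: C'_def intro: le_max_iff_disj[THEN iffD2])
  define h where "h k y = f (min y k)" for k y
  have inc: "incseq f"
    using g(1) u_pos by (intro incseq_SucI) (simp add: u_grad_def fwd_diff_def zero_le_divide_iff order.strict_iff_not)
  have f0: "0 \<le> f y" for y using incseqD[OF inc, of 0 y] f by simp
  have gh: "u_grad u (h k) y = (if y < k then u_grad u f y else 0)" for k y
    by (auto simp: u_grad_def fwd_diff_def h_def min_def)
  have gh': "0 \<le> u_grad u (h k) y" "u_grad u (h k) y \<le> C'" for k y
    using g C' by (auto simp: gh)
  have hb: "0 \<le> h k y" "h k y \<le> f k" for k y
    using f0 incseqD[OF inc] by (auto simp: h_def)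
  have limh: "(\<lambda>k. sem (h k) t y) \<longlonglongrightarrow> sem f t y" for y
    by (rule fk_min_tendsto_of_local_agreement) (use t f0 incseqD[OF inc] in \<open>auto simp: h_def\<close>)
  have limg: "(\<lambda>k. usem (u_grad u (h (k + 1))) t y) \<longlonglongrightarrow> usem (u_grad u f) t y" for y
    by (rule fk_min_tendsto_of_local_agreement) (use t g in \<open>auto simp: gh\<close>)
  have usem_fin: "usem q t y < \<top>" if "\<And>z. q z \<le> C'" for q y
    using usem_le(1)[OF C'(1) that t] by (rule le_less_trans) simp
  have ufin: "usem (u_grad u f) t y < \<top>" for y
    by (rule usem_fin) (rule C'(2))
  have sem_fin: "sem (h k) t y < \<top>" for k y
  proof -
    have "sem (h k) t y \<le> ennreal (max (f k) 1)"
      using hb t by (intro sem_le) (auto intro: le_max_iff_disj[THEN iffD2])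
    then show ?thesis by (rule le_less_trans) simp
  qed
  have step_h: "sem (h k) t (y + 1) = sem (h k) t y + ennreal (u y) * usem (u_grad u (h k)) t y" for k y
  proof -
    have "enn2real (sem (h k) t (y + 1)) = enn2real (sem (h k) t y) + u y * enn2real (usem (u_grad u (h k)) t y)"
      using bounded_intertwining[OF hb(1)[of k] hb(2)[of k] gh'(1)[of k] gh'(2)[of k] t, of y] by simp
    then have "ennreal (enn2real (sem (h k) t (y + 1))) =
        ennreal (enn2real (sem (h k) t y)) + ennreal (u y) * ennreal (enn2real (usem (u_grad u (h k)) t y))"
      using u_pos[of y] by (simp add: ennreal_mult)
    then show ?thesis using sem_fin usem_fin[of "u_grad u (h k)"] gh'(2) by simp
  qed
  \<comment> \<open>The additive form of the identity passes to the limit before finiteness is known.\<close>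
  have step: "sem f t (y + 1) = sem f t y + ennreal (u y) * usem (u_grad u f) t y" for y
  proof (rule LIMSEQ_unique)
    show "(\<lambda>k. sem (h (k + 1)) t (y + 1)) \<longlonglongrightarrow> sem f t (y + 1)"
      by (rule LIMSEQ_ignore_initial_segment[OF limh])
    show "(\<lambda>k. sem (h (k + 1)) t (y + 1)) \<longlonglongrightarrow> sem f t y + ennreal (u y) * usem (u_grad u f) t y"
      unfolding step_h
      by (intro tendsto_add ennreal_tendsto_cmult limg LIMSEQ_ignore_initial_segment[OF limh]) simp
  qed
  have "sem f t 0 \<le> ennreal (lam 0 * u 0 * (exp (\<bar>K\<bar> * t) * C') * t)"
  proof (rule LIMSEQ_le_const2[OF limh], intro exI allI impI)
    show "sem (h k) t 0 \<le> ennreal (lam 0 * u 0 * (exp (\<bar>K\<bar> * t) * C') * t)" for k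
      using sem_at_0_le[OF hb(1)[of k] hb(2)[of k] gh'(1)[of k] gh'(2)[of k] C'(1) t] f by (simp add: h_def)
  qed
  then have "sem f t 0 < \<top>" by (rule le_less_trans) simp
  then show fin: "sem f t x < \<top>" for x
  proof (induction x)
    case (Suc x)
    then show ?case using step[of x] ufin[of x] by (simp add: ennreal_mult_less_top)
  qed
  have "enn2real (sem f t (x + 1)) = enn2real (sem f t x) + u x * enn2real (usem (u_grad u f) t x)"
    unfolding step using fin[of x] ufin[of x] u_pos[of x]
    by (simp add: enn2real_plus ennreal_mult_less_top enn2real_mult)
  then show "enn2real (sem f t (x + 1)) - enn2real (sem f t x) = u x * enn2real (usem (u_grad u f) t x)"
    by simp
qed

end

section \<open>The law of the jump chain and the holding times\<close>

lemma jump_rate_bd: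
  assumes "b 0 = 0"
  shows "jump_rate (bd_generator a b) x y = (if y = x + 1 then a x else 0) + (if y + 1 = x then b x else 0)"
  using assms by (cases x) (auto simp: jump_rate_def bd_generator_def fwd_diff_def bwd_diff_def indicator_def)

lemma exit_rate_bd:
  assumes "b 0 = 0"
  shows "exit_rate (bd_generator a b) x = a x + b x"
  using assms by (cases x) (auto simp: exit_rate_def bd_generator_def fwd_diff_def bwd_diff_def indicator_def)

definition seq_space :: "(nat \<Rightarrow> nat \<times> real) measure" where
  "seq_space = PiM UNIV (\<lambda>_. count_space UNIV \<Otimes>\<^sub>M borel)"

lemma space_seq_space: "space seq_space = UNIV"
  by (simp add: seq_space_def space_PiM space_pair_measure)

lemma measurable_seq_space_component [measurable]: "(\<lambda>w. w i) \<in> seq_space \<rightarrow>\<^sub>M count_space UNIV \<Otimes>\<^sub>M borel"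
  unfolding seq_space_def by measurable

lemma measurable_seq_space_shift [measurable]: "(\<lambda>w n. w (Suc n)) \<in> seq_space \<rightarrow>\<^sub>M seq_space"
  unfolding seq_space_def
  by (rule measurable_PiM_single') (auto simp: space_PiM space_pair_measure)

lemma measurable_seq_space_case_nat [measurable]:
  "(\<lambda>(s, w). case_nat (x, s) w) \<in> (borel \<Otimes>\<^sub>M seq_space) \<rightarrow>\<^sub>M seq_space"
  unfolding seq_space_def
proof (rule measurable_PiM_single')
  fix i :: nat
  show "(\<lambda>p. (case p of (s, w) \<Rightarrow> case_nat (x, s) w) i)
    \<in> borel \<Otimes>\<^sub>M Pi\<^sub>M UNIV (\<lambda>_. count_space UNIV \<Otimes>\<^sub>M borel) \<rightarrow>\<^sub>M count_space UNIV \<Otimes>\<^sub>M borel"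
    by (cases i) (auto simp: split_beta')
qed (auto simp: space_PiM space_pair_measure)

text \<open>
  The events whose probabilities the definition of a minimal chain prescribes.
\<close>

definition cyl :: "nat \<Rightarrow> (nat \<Rightarrow> nat) \<Rightarrow> (nat \<Rightarrow> real) \<Rightarrow> (nat \<Rightarrow> nat \<times> real) set" where
  "cyl n y s = {w. \<forall>i\<le>n. fst (w i) = y i \<and> s i < snd (w i)}"

lemma cyl_sets [measurable]: "cyl n y s \<in> sets seq_space"
proof -
  have "cyl n y s = {w \<in> space seq_space. \<forall>i\<le>n. fst (w i) = y i \<and> s i < snd (w i)}"
    by (simp add: cyl_def space_seq_space)
  also have "\<dots> \<in> sets seq_space" by measurable
  finally show ?thesis .
qed

definition cyls :: "(nat \<Rightarrow> nat \<times> real) set set" where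
  "cyls = insert {} {cyl n y s | n y s. True}"

lemma cyl_Int: "cyl n y s \<inter> cyl n' y' s' \<in> cyls"
proof (induction n n' arbitrary: y s y' s' rule: linorder_wlog)
  case (le n n')
  show ?case
  proof (cases "\<forall>i\<le>n. y i = y' i")
    case True
    then have "cyl n y s \<inter> cyl n' y' s' = cyl n' y' (\<lambda>i. if i \<le> n then max (s i) (s' i) else s' i)"
      using le by (auto simp: cyl_def)
    then show ?thesis by (auto simp: cyls_def)
  next
    case False
    then have "cyl n y s \<inter> cyl n' y' s' = {}"
      using le by (auto simp: cyl_def)
    then show ?thesis by (simp add: cyls_def)
  qed
next
  case (sym n n')
  then show ?case by (simp add: Int_commute)
qed

lemma Int_stable_cyls: "Int_stable cyls"
proof (rule Int_stableI)
  fix A B assume "A \<in> cyls" "B \<in> cyls"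
  then show "A \<inter> B \<in> cyls" using cyl_Int by (auto simp: cyls_def) blast
qed

text \<open>
  The events {state i = k, holding time i > c} are countable unions of cylinders and generate: the earlier states are enumerated by
  lists, and the bounds on the earlier coordinates are relaxed to -m.
\<close>

lemma sets_seq_space: "sets seq_space = sigma_sets UNIV cyls"
proof
  show "sigma_sets UNIV cyls \<subseteq> sets seq_space"
  proof -
    have "cyls \<subseteq> sets seq_space" using cyl_sets by (auto simp: cyls_def)
    then show ?thesis using sets.sigma_sets_subset[of cyls seq_space] by (simp add: space_seq_space)
  qed
next
  let ?N = "sigma UNIV cyls"
  have sN: "sets ?N = sigma_sets UNIV cyls" "space ?N = UNIV" by auto
  have cyl_N: "cyl n y s \<in> sets ?N" for n y s
    unfolding sN by (rule sigma_sets.Basic) (auto simp: cyls_def)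
  have basic: "{w. fst (w i) = k \<and> c < snd (w i)} \<in> sets ?N" for i k c
  proof -
    have "{w. fst (w i) = k \<and> c < snd (w i)} =
      (\<Union>l::nat list. \<Union>m::nat. cyl i ((\<lambda>j. l ! j)(i := k)) ((\<lambda>j. - real m)(i := c)))" (is "?L = ?R")
    proof
      show "?R \<subseteq> ?L" by (auto simp: cyl_def)
      show "?L \<subseteq> ?R"
      proof
        fix w assume w: "w \<in> ?L"
        define l where "l = map (\<lambda>j. fst (w j)) [0..<i]"
        obtain m :: nat where m: "Max ((\<lambda>j. - snd (w j)) ` {..i}) < real m"
          using reals_Archimedean2 by blast
        have "- real m < snd (w j)" if "j \<le> i" for j
        proof -
          have "- snd (w j) \<le> Max ((\<lambda>j. - snd (w j)) ` {..i})" using that by (intro Max_ge) auto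
          then show ?thesis using m by linarith
        qed
        then have "w \<in> cyl i ((\<lambda>j. l ! j)(i := k)) ((\<lambda>j. - real m)(i := c))"
          using w by (auto simp: cyl_def l_def)
        then show "w \<in> ?R" by blast
      qed
    qed
    also have "\<dots> \<in> sets ?N" by (intro sets.countable_UN' countableI_type image_subsetI cyl_N)
    finally show ?thesis .
  qed
  have comp: "(\<lambda>w. w i) \<in> ?N \<rightarrow>\<^sub>M count_space UNIV \<Otimes>\<^sub>M borel" for i
  proof (rule measurable_pair)
    have "{w. fst (w i) = k} \<in> sets ?N" for k
    proof -
      have "{w :: nat \<Rightarrow> nat \<times> real. fst (w i) = k} = (\<Union>m::nat. {w. fst (w i) = k \<and> - real m < snd (w i)})"
      proof (intro set_eqI iffI)
        fix w :: "nat \<Rightarrow> nat \<times> real" assume "w \<in> {w. fst (w i) = k}"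
        moreover obtain m :: nat where "- snd (w i) < real m" using reals_Archimedean2 by blast
        ultimately show "w \<in> (\<Union>m::nat. {w. fst (w i) = k \<and> - real m < snd (w i)})" by (auto intro!: exI[of _ m])
      qed auto
      also have "\<dots> \<in> sets ?N" by (intro sets.countable_UN' countableI_type image_subsetI basic)
      finally show ?thesis .
    qed
    then show "fst \<circ> (\<lambda>w. w i) \<in> ?N \<rightarrow>\<^sub>M count_space UNIV"
      by (subst measurable_count_space_eq2_countable) (auto simp: vimage_def)
    have "{w. c < snd (w i)} \<in> sets ?N" for c
    proof -
      have "{w :: nat \<Rightarrow> nat \<times> real. c < snd (w i)} = (\<Union>k. {w. fst (w i) = k \<and> c < snd (w i)})" by auto
      also have "\<dots> \<in> sets ?N" by (intro sets.countable_UN' countableI_type image_subsetI basic)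
      finally show ?thesis .
    qed
    then show "snd \<circ> (\<lambda>w. w i) \<in> borel_measurable ?N"
      by (subst borel_measurable_iff_greater) (auto)
  qed
  have "(\<lambda>w. w) \<in> ?N \<rightarrow>\<^sub>M seq_space"
    unfolding seq_space_def
  proof (rule measurable_PiM_single')
    show "(\<lambda>w. w i) \<in> ?N \<rightarrow>\<^sub>M count_space UNIV \<Otimes>\<^sub>M borel" for i by (rule comp)
    show "(\<lambda>w. w) \<in> space ?N \<rightarrow> (\<Pi>\<^sub>E i\<in>UNIV. space (count_space UNIV \<Otimes>\<^sub>M borel))"
      unfolding space_pair_measure by simp
  qed
  then have "A \<in> sets ?N" if "A \<in> sets seq_space" for A
    using measurable_sets[of "\<lambda>w. w" ?N seq_space A] that unfolding sN(2) vimage_ident Int_UNIV_right by simp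
  then show "sets seq_space \<subseteq> sigma_sets UNIV cyls" unfolding sN(1) by (rule subsetI)
qed

text \<open>
  Dynkin's argument for the decomposition at the first jump: a birth--death chain moves to one of two states,
  so its law is a mixture of two measures.
\<close>

lemma mixture_eqI_cyls:
  fixes \<mu> \<nu>1 \<nu>2 :: "(nat \<Rightarrow> nat \<times> real) measure"
  assumes sets: "sets \<mu> = sets seq_space" "sets \<nu>1 = sets seq_space" "sets \<nu>2 = sets seq_space"
    and prob: "prob_space \<mu>" "prob_space \<nu>1" "prob_space \<nu>2"
    and p: "p1 + p2 = 1"
    and cyl: "\<And>n y s. measure \<mu> (cyl n y s) = p1 * measure \<nu>1 (cyl n y s) + p2 * measure \<nu>2 (cyl n y s)"
    and A: "A \<in> sets seq_space"
  shows "measure \<mu> A = p1 * measure \<nu>1 A + p2 * measure \<nu>2 A"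
proof -
  interpret m: prob_space \<mu> by fact
  interpret n1: prob_space \<nu>1 by fact
  interpret n2: prob_space \<nu>2 by fact
  have sp: "space \<mu> = UNIV" "space \<nu>1 = UNIV" "space \<nu>2 = UNIV"
    using sets by (auto dest!: sets_eq_imp_space_eq simp: space_seq_space)
  have cyls_Pow: "cyls \<subseteq> Pow UNIV" by simp
  from A have "A \<in> sigma_sets UNIV cyls" by (simp add: sets_seq_space)
  with Int_stable_cyls cyls_Pow show ?thesis
  proof (induction rule: sigma_sets_induct_disjoint)
    case (basic B)
    then show ?case by (auto simp: cyls_def cyl)
  next
    case (compl B)
    then have B: "B \<in> sets seq_space" by (simp add: sets_seq_space)
    have "measure \<mu> (UNIV - B) = 1 - measure \<mu> B" "measure \<nu>1 (UNIV - B) = 1 - measure \<nu>1 B"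
      "measure \<nu>2 (UNIV - B) = 1 - measure \<nu>2 B"
      using m.prob_compl[of B] n1.prob_compl[of B] n2.prob_compl[of B] B by (simp_all add: sets sp)
    moreover have "p1 * (1 - measure \<nu>1 B) + p2 * (1 - measure \<nu>2 B) =
        (p1 + p2) - (p1 * measure \<nu>1 B + p2 * measure \<nu>2 B)"
      by (simp add: algebra_simps)
    ultimately show ?case using compl.IH p by simp
  next
    case (union B)
    then have B: "range B \<subseteq> sets seq_space" by (simp add: sets_seq_space)
    have "(\<lambda>i. p1 * measure \<nu>1 (B i) + p2 * measure \<nu>2 (B i)) sums
        (p1 * measure \<nu>1 (\<Union>i. B i) + p2 * measure \<nu>2 (\<Union>i. B i))"
      by (intro sums_add sums_mult n1.finite_measure_UNION n2.finite_measure_UNION)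
         (use B union in \<open>auto simp: sets\<close>)
    moreover have "(\<lambda>i. p1 * measure \<nu>1 (B i) + p2 * measure \<nu>2 (B i)) sums measure \<mu> (\<Union>i. B i)"
      unfolding union.IH[symmetric]
      by (intro m.finite_measure_UNION) (use B union in \<open>auto simp: sets\<close>)
    ultimately show ?case by (rule sums_unique2[symmetric])
  qed auto
qed

lemma mixture_nn_integral:
  fixes \<mu> \<nu>1 \<nu>2 :: "'c measure"
  assumes sets: "sets \<nu>1 = sets \<mu>" "sets \<nu>2 = sets \<mu>"
    and eq: "\<And>A. A \<in> sets \<mu> \<Longrightarrow> emeasure \<mu> A = p1 * emeasure \<nu>1 A + p2 * emeasure \<nu>2 A"
    and F: "F \<in> borel_measurable \<mu>"
  shows "(\<integral>\<^sup>+ w. F w \<partial>\<mu>) = p1 * (\<integral>\<^sup>+ w. F w \<partial>\<nu>1) + p2 * (\<integral>\<^sup>+ w. F w \<partial>\<nu>2)"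
proof -
  note [measurable_cong] = sets
  have sp: "space \<nu>1 = space \<mu>" "space \<nu>2 = space \<mu>" using sets by (auto dest: sets_eq_imp_space_eq)
  show ?thesis using F
  proof (induction rule: borel_measurable_induct)
    case (cong f g)
    have "integral\<^sup>N M f = integral\<^sup>N M g" if "space M = space \<mu>" for M
      using cong that by (intro nn_integral_cong) auto
    then show ?case using cong.IH sp by metis
  next
    case (set A)
    then show ?case using sets eq by simp
  next
    case (mult f c)
    then have [measurable]: "f \<in> borel_measurable \<nu>1" "f \<in> borel_measurable \<nu>2" by measurable
    show ?case using mult by (simp add: nn_integral_cmult distrib_left mult_ac)
  next
    case (add f g)
    note [measurable] = add.hyps
    have "f \<in> borel_measurable \<nu>1" "f \<in> borel_measurable \<nu>2" "g \<in> borel_measurable \<nu>1" "g \<in> borel_measurable \<nu>2"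
      by measurable
    then show ?case using add by (simp add: nn_integral_add distrib_left ac_simps)
  next
    case (seq U)
    note [measurable] = seq.hyps(1)
    have [measurable]: "U i \<in> borel_measurable \<nu>1" "U i \<in> borel_measurable \<nu>2" for i by measurable
    have U: "(SUP i. U i) = (\<lambda>x. SUP i. U i x)" by (simp add: fun_eq_iff image_comp)
    have e: "integral\<^sup>N \<mu> (SUP i. U i) = (SUP i. integral\<^sup>N \<mu> (U i))"
         "integral\<^sup>N \<nu>1 (SUP i. U i) = (SUP i. integral\<^sup>N \<nu>1 (U i))"
         "integral\<^sup>N \<nu>2 (SUP i. U i) = (SUP i. integral\<^sup>N \<nu>2 (U i))"
      using seq nn_integral_monotone_convergence_SUP[of U \<mu>] nn_integral_monotone_convergence_SUP[of U \<nu>1]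
        nn_integral_monotone_convergence_SUP[of U \<nu>2]
      unfolding U by simp_all
    have "incseq (\<lambda>i. integral\<^sup>N M (U i))" for M
      using seq.hyps by (auto simp: incseq_def le_fun_def intro!: nn_integral_mono)
    then have "integral\<^sup>N \<mu> (SUP i. U i) = p1 * integral\<^sup>N \<nu>1 (SUP i. U i) + p2 * integral\<^sup>N \<nu>2 (SUP i. U i)"
      unfolding e seq.IH
      by (simp add: SUP_mult_left_ennreal ennreal_SUP_add incseq_def mult_left_mono)
    then show ?case unfolding seq.hyps .
  qed
qed

text \<open>
  The content of the definition of a minimal chain, apart from the path itself.
\<close>

locale bd_chain =
  fixes a b :: "nat \<Rightarrow> real" and P :: "nat \<Rightarrow> 'w measure"
    and Y :: "nat \<Rightarrow> 'w \<Rightarrow> nat" and S :: "nat \<Rightarrow> 'w \<Rightarrow> real"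
  assumes a_pos: "\<And>x. 0 < a x" and b_nonneg: "\<And>x. 0 \<le> b x" and b_0: "b 0 = 0"
    and prob_P: "\<And>x. prob_space (P x)"
    and Y_measurable: "\<And>x n. Y n \<in> P x \<rightarrow>\<^sub>M count_space UNIV"
    and S_measurable: "\<And>x n. S n \<in> borel_measurable (P x)"
    and S_pos: "\<And>x \<omega> n. \<omega> \<in> space (P x) \<Longrightarrow> 0 < S n \<omega>"
    and law: "\<And>x n y s. (\<And>i. i \<le> n \<Longrightarrow> 0 \<le> s i) \<Longrightarrow>
        measure (P x) {\<omega> \<in> space (P x). \<forall>i\<le>n. Y i \<omega> = y i \<and> s i < S i \<omega>} =
        (if y 0 = x then 1 else 0) *
        (\<Prod>i<n. jump_rate (bd_generator a b) (y i) (y (Suc i)) / exit_rate (bd_generator a b) (y i)) *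
        (\<Prod>i\<le>n. exp (- (exit_rate (bd_generator a b) (y i) * s i)))"
begin

definition q :: "nat \<Rightarrow> real" where "q x = a x + b x"

lemma q_pos: "0 < q x" using a_pos[of x] b_nonneg[of x] by (simp add: q_def)

definition marked_path :: "'w \<Rightarrow> nat \<Rightarrow> nat \<times> real" where "marked_path \<omega> = (\<lambda>i. (Y i \<omega>, S i \<omega>))"

lemma marked_path_measurable [measurable]: "marked_path \<in> P x \<rightarrow>\<^sub>M seq_space"
proof -
  note [measurable] = Y_measurable S_measurable
  show ?thesis unfolding seq_space_def marked_path_def
    by (rule measurable_PiM_single') (auto simp: space_pair_measure)
qed

definition path_law :: "nat \<Rightarrow> (nat \<Rightarrow> nat \<times> real) measure" where "path_law x = distr (P x) seq_space marked_path"

lemma sets_path_law [simp, measurable_cong]: "sets (path_law x) = sets seq_space" by (simp add: path_law_def)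
lemma space_path_law [simp]: "space (path_law x) = UNIV" by (simp add: path_law_def space_seq_space)
lemma prob_path_law: "prob_space (path_law x)"
  unfolding path_law_def by (intro prob_space.prob_space_distr prob_P marked_path_measurable)

lemma path_law_cyl:
  "measure (path_law x) (cyl n y s) = (if y 0 = x then 1 else 0) *
    (\<Prod>i<n. jump_rate (bd_generator a b) (y i) (y (Suc i)) / q (y i)) * (\<Prod>i\<le>n. exp (- (q (y i) * max 0 (s i))))"
proof -
  have "measure (path_law x) (cyl n y s) = measure (P x) (marked_path -` cyl n y s \<inter> space (P x))"
    unfolding path_law_def by (rule measure_distr[OF marked_path_measurable]) simp
  also have "marked_path -` cyl n y s \<inter> space (P x) = {\<omega> \<in> space (P x). \<forall>i\<le>n. Y i \<omega> = y i \<and> max 0 (s i) < S i \<omega>}"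
    using S_pos by (auto simp: cyl_def marked_path_def)
  also have "measure (P x) \<dots> = (if y 0 = x then 1 else 0) *
        (\<Prod>i<n. jump_rate (bd_generator a b) (y i) (y (Suc i)) / exit_rate (bd_generator a b) (y i)) *
        (\<Prod>i\<le>n. exp (- (exit_rate (bd_generator a b) (y i) * max 0 (s i))))"
    by (rule law) simp
  finally show ?thesis unfolding exit_rate_bd[of b, OF b_0] q_def .
qed

lemma path_law_cyl_0: "measure (path_law x) (cyl 0 y s) = (if y 0 = x then 1 else 0) * exp (- (q x * max 0 (s 0)))"
  by (simp add: path_law_cyl)

lemma path_law_cyl_Suc:
  "measure (path_law x) (cyl (Suc n) y s) = (if y 0 = x then 1 else 0) * exp (- (q x * max 0 (s 0))) *
     (jump_rate (bd_generator a b) x (y 1) / q x) * measure (path_law (y 1)) (cyl n (\<lambda>i. y (Suc i)) (\<lambda>i. s (Suc i)))"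
  unfolding path_law_cyl prod.lessThan_Suc_shift prod.atMost_Suc_shift by simp

definition holding :: "nat \<Rightarrow> real measure" where "holding x = density lborel (exponential_density (q x))"

lemma sets_holding [simp, measurable_cong]: "sets (holding x) = sets borel" by (simp add: holding_def)
lemma space_holding [simp]: "space (holding x) = UNIV" by (simp add: holding_def)
lemma prob_holding: "prob_space (holding x)"
  unfolding holding_def by (rule prob_space_exponential_density[OF q_pos])

lemma holding_greater: "measure (holding x) {c<..} = exp (- (q x * max 0 c))"
proof -
  interpret prob_space "holding x" by (rule prob_holding)
  have D: "distributed (holding x) lborel (\<lambda>s. s) (exponential_density (q x))"
    unfolding distributed_def by (auto simp: holding_def distr_id2 exponential_density_nonneg[OF q_pos])
  have gt: "measure (holding x) {c<..} = exp (- (q x * c))" if "0 \<le> c" for c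
    using exponential_distributedD_gt[OF D that] q_pos[of x]
    by (simp add: mult.commute greaterThan_def)
  show ?thesis
  proof (cases "0 \<le> c")
    case False
    \<comment> \<open>A bound c < 0 imposes nothing, since holding times are positive.\<close>
    have "measure (holding x) {0<..} \<le> measure (holding x) {c<..}"
      using False by (intro finite_measure_mono) auto
    then have "measure (holding x) {c<..} = 1" using gt[of 0] prob_le_1[of "{c<..}"] by simp
    then show ?thesis using False by simp
  qed (simp add: gt)
qed

text \<open>
  The law of a path that stays at x for an exponential time and then continues as the chain started at x'.
\<close>

definition step_law :: "nat \<Rightarrow> nat \<Rightarrow> (nat \<Rightarrow> nat \<times> real) measure" where
  "step_law x x' = distr (holding x \<Otimes>\<^sub>M path_law x') seq_space (\<lambda>(s, w). case_nat (x, s) w)"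

lemma case_nat_measurable: "(\<lambda>(s, w). case_nat (x, s) w) \<in> holding x'' \<Otimes>\<^sub>M path_law x' \<rightarrow>\<^sub>M seq_space"
proof -
  have "sets (holding x'' \<Otimes>\<^sub>M path_law x') = sets (borel \<Otimes>\<^sub>M seq_space)" by (intro sets_pair_measure_cong) auto
  then show ?thesis using measurable_seq_space_case_nat[of x] measurable_cong_sets by blast
qed

lemma prob_step_law: "prob_space (step_law x x')"
  unfolding step_law_def
  by (intro prob_space.prob_space_distr prob_space_pair prob_holding prob_path_law case_nat_measurable)

lemma step_law_cyl:
  "measure (step_law x x') (cyl 0 y s) = (if y 0 = x then 1 else 0) * exp (- (q x * max 0 (s 0)))" (is ?A)
  "measure (step_law x x') (cyl (Suc n) y s) = (if y 0 = x then 1 else 0) * exp (- (q x * max 0 (s 0))) *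
      measure (path_law x') (cyl n (\<lambda>i. y (Suc i)) (\<lambda>i. s (Suc i)))" (is ?B)
proof -
  interpret E: prob_space "holding x" by (rule prob_holding)
  interpret M: prob_space "path_law x'" by (rule prob_path_law)
  interpret pair_prob_space "holding x" "path_law x'" ..
  have times: "measure (holding x \<Otimes>\<^sub>M path_law x') (A \<times> B) = measure (holding x) A * measure (path_law x') B"
    if "A \<in> sets borel" "B \<in> sets seq_space" for A B
    using that by (simp add: measure_def M.emeasure_pair_measure_Times enn2real_mult)
  have pre: "measure (step_law x x') (cyl n y s) =
    measure (holding x \<Otimes>\<^sub>M path_law x') ((\<lambda>(s, w). case_nat (x, s) w) -` cyl n y s)" for n
    unfolding step_law_def
    by (subst measure_distr[OF case_nat_measurable]) (auto simp: space_pair_measure)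
  have "(\<lambda>(s, w). case_nat (x, s) w) -` cyl 0 y s = (if y 0 = x then {s 0<..} \<times> UNIV else {})"
    by (auto simp: cyl_def)
  then show ?A unfolding pre
    using M.prob_space by (auto simp: times holding_greater space_seq_space[symmetric])
  have "(\<lambda>(s, w). case_nat (x, s) w) -` cyl (Suc n) y s =
    (if y 0 = x then {s 0<..} \<times> cyl n (\<lambda>i. y (Suc i)) (\<lambda>i. s (Suc i)) else {})"
    by (auto simp: cyl_def All_less_Suc2 less_Suc_eq_le[symmetric])
  then show ?B unfolding pre
    by (auto simp: times holding_greater)
qed

text \<open>
  The Markov property at the first jump, checked on cylinders, where both sides are the prescribed products.
\<close>

lemma first_step:
  assumes "A \<in> sets seq_space"
  shows "measure (path_law x) A = a x / q x * measure (step_law x (x + 1)) A + b x / q x * measure (step_law x (x - 1)) A"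
proof (rule mixture_eqI_cyls[OF _ _ _ prob_path_law prob_step_law prob_step_law _ _ assms])
  show "a x / q x + b x / q x = 1"
    using q_pos[of x] by (simp add: q_def add_divide_distrib[symmetric])
  then have p: "a x / q x * r + b x / q x * r = r" for r by (metis distrib_right mult_1)
  fix n y s
  show "measure (path_law x) (cyl n y s) = a x / q x * measure (step_law x (x + 1)) (cyl n y s)
      + b x / q x * measure (step_law x (x - 1)) (cyl n y s)"
  proof (cases n)
    case 0
    show ?thesis unfolding 0 step_law_cyl(1) p by (rule path_law_cyl_0)
  next
    case (Suc m)
    let ?C = "cyl m (\<lambda>i. y (Suc i)) (\<lambda>i. s (Suc i))"
    have zero: "measure (path_law z) ?C = 0" if "z \<noteq> y 1" for z
      using that by (simp add: path_law_cyl)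
    have J: "jump_rate (bd_generator a b) x (y 1) / q x * measure (path_law (y 1)) ?C
      = a x / q x * measure (path_law (x + 1)) ?C + b x / q x * measure (path_law (x - 1)) ?C"
      using zero[of "x + 1"] zero[of "x - 1"] b_0
      by (cases x) (auto simp: jump_rate_bd[of b, OF b_0])
    show ?thesis
      unfolding Suc path_law_cyl_Suc step_law_cyl(2) mult.assoc J
      by (simp only: distrib_left mult.left_commute)
  qed
qed (simp_all add: step_law_def)

lemma first_step_nn_integral:
  assumes F [measurable]: "F \<in> borel_measurable seq_space"
  shows "(\<integral>\<^sup>+ w. F w \<partial>path_law x) =
    (\<integral>\<^sup>+ s. ennreal (exponential_density (q x) s) *
      (ennreal (a x / q x) * (\<integral>\<^sup>+ w. F (case_nat (x, s) w) \<partial>path_law (x + 1)) +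
       ennreal (b x / q x) * (\<integral>\<^sup>+ w. F (case_nat (x, s) w) \<partial>path_law (x - 1))) \<partial>lborel)"
proof -
  have nn: "0 \<le> a x / q x" "0 \<le> b x / q x" using a_pos[of x] b_nonneg[of x] q_pos[of x] by auto
  interpret m: prob_space "path_law z" for z by (rule prob_path_law)
  have Fm: "(\<lambda>s. \<integral>\<^sup>+ w. F (case_nat (x, s) w) \<partial>path_law z) \<in> borel_measurable borel" for z
  proof -
    have "(\<lambda>(s, w). F (case_nat (x, s) w)) \<in> borel_measurable (borel \<Otimes>\<^sub>M seq_space)"
      using measurable_compose[OF measurable_seq_space_case_nat[of x] F] by (simp add: split_beta')
    then have "(\<lambda>(s, w). F (case_nat (x, s) w)) \<in> borel_measurable (borel \<Otimes>\<^sub>M path_law z)"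
      by (subst measurable_cong_sets[OF sets_pair_measure_cong[OF refl sets_path_law] refl])
    then show ?thesis using m.borel_measurable_nn_integral_fst by fastforce
  qed
  have step: "(\<integral>\<^sup>+ w. F w \<partial>step_law x z) =
      (\<integral>\<^sup>+ s. ennreal (exponential_density (q x) s) * (\<integral>\<^sup>+ w. F (case_nat (x, s) w) \<partial>path_law z) \<partial>lborel)" for z
  proof -
    have "(\<integral>\<^sup>+ w. F w \<partial>step_law x z) = (\<integral>\<^sup>+ p. F ((\<lambda>(s, w). case_nat (x, s) w) p) \<partial>(holding x \<Otimes>\<^sub>M path_law z))"
      unfolding step_law_def by (rule nn_integral_distr[OF case_nat_measurable]) simp
    also have "\<dots> = (\<integral>\<^sup>+ s. \<integral>\<^sup>+ w. F (case_nat (x, s) w) \<partial>path_law z \<partial>holding x)"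
      using m.nn_integral_fst[of "\<lambda>p. F ((\<lambda>(s, w). case_nat (x, s) w) p)" "holding x" z]
        measurable_compose[OF case_nat_measurable F] by simp
    also have "\<dots> = (\<integral>\<^sup>+ s. ennreal (exponential_density (q x) s) * (\<integral>\<^sup>+ w. F (case_nat (x, s) w) \<partial>path_law z) \<partial>lborel)"
      unfolding holding_def using Fm by (intro nn_integral_density) auto
    finally show ?thesis .
  qed
  have eq: "emeasure (path_law x) A = ennreal (a x / q x) * emeasure (step_law x (x + 1)) A +
      ennreal (b x / q x) * emeasure (step_law x (x - 1)) A" if "A \<in> sets (path_law x)" for A
  proof -
    interpret s: prob_space "step_law x z" for z by (rule prob_step_law)
    have "ennreal (p * m + p' * m') = ennreal p * ennreal m + ennreal p' * ennreal m'"
      if "0 \<le> p" "0 \<le> p'" "0 \<le> m" "0 \<le> m'" for p m p' m' :: real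
      using that by (simp add: ennreal_mult)
    from this[OF nn] show ?thesis
      unfolding m.emeasure_eq_measure s.emeasure_eq_measure
      using first_step[of A x] that by simp
  qed
  have "(\<integral>\<^sup>+ w. F w \<partial>path_law x) = ennreal (a x / q x) * (\<integral>\<^sup>+ w. F w \<partial>step_law x (x + 1)) +
      ennreal (b x / q x) * (\<integral>\<^sup>+ w. F w \<partial>step_law x (x - 1))"
    by (rule mixture_nn_integral[OF _ _ eq]) (auto simp: step_law_def)
  also have "\<dots> = (\<integral>\<^sup>+ s. ennreal (a x / q x) * (ennreal (exponential_density (q x) s) * (\<integral>\<^sup>+ w. F (case_nat (x, s) w) \<partial>path_law (x + 1))) +
       ennreal (b x / q x) * (ennreal (exponential_density (q x) s) * (\<integral>\<^sup>+ w. F (case_nat (x, s) w) \<partial>path_law (x - 1))) \<partial>lborel)"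
    unfolding step using Fm by (simp add: nn_integral_add nn_integral_cmult)
  finally show ?thesis by (simp add: distrib_left mult_ac)
qed

end

section \<open>Feynman--Kac functionals as minimal solutions\<close>

text \<open>
  The Feynman--Kac functional on paths with fewer than m jumps up to time t, and 0 on the others, as a recursion over the
  first holding time.
\<close>

fun path_iter :: "(nat \<Rightarrow> real) \<Rightarrow> (nat \<Rightarrow> real) \<Rightarrow> nat \<Rightarrow> real \<Rightarrow> (nat \<Rightarrow> nat \<times> real) \<Rightarrow> ennreal" where
  "path_iter V g 0 t w = 0"
| "path_iter V g (Suc m) t w =
     (if t < snd (w 0) then ennreal (g (fst (w 0)) * exp (- (V (fst (w 0)) * t)))
      else ennreal (exp (- (V (fst (w 0)) * snd (w 0)))) * path_iter V g m (t - snd (w 0)) (\<lambda>n. w (Suc n)))"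

lemma path_iter_measurable [measurable]:
  "(\<lambda>(t, w). path_iter V g m t w) \<in> borel_measurable (borel \<Otimes>\<^sub>M seq_space)"
proof (induction m)
  case (Suc m)
  have [measurable]: "(\<lambda>p. path_iter V g m (fst p - snd (snd p 0)) (\<lambda>n. snd p (Suc n))) \<in> borel_measurable (borel \<Otimes>\<^sub>M seq_space)"
  proof -
    have "(\<lambda>p. (fst p - snd (snd p 0), \<lambda>n. snd p (Suc n))) \<in> borel \<Otimes>\<^sub>M seq_space \<rightarrow>\<^sub>M borel \<Otimes>\<^sub>M seq_space"
      by measurable
    from measurable_compose[OF this Suc] show ?thesis by (simp add: split_beta')
  qed
  have [measurable]: "V \<in> borel_measurable (count_space UNIV)" "g \<in> borel_measurable (count_space UNIV)" by auto
  show ?case unfolding path_iter.simps split_beta' by measurable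
qed simp

lemma path_iter_measurable' [measurable]: "(\<lambda>w. path_iter V g m t w) \<in> borel_measurable seq_space"
  using measurable_compose[OF measurable_Pair1'[of t borel seq_space] path_iter_measurable[of V g m]] by simp

lemma path_iter_Suc_le: "path_iter V g m t w \<le> path_iter V g (Suc m) t w"
proof (induction m arbitrary: t w)
  case (Suc m)
  then show ?case
    unfolding path_iter.simps(2)[of V g m t w] path_iter.simps(2)[of V g "Suc m" t w]
    by (cases "t < snd (w 0)") (simp_all add: Suc mult_left_mono del: path_iter.simps)
qed simp

lemma incseq_path_iter: "incseq (\<lambda>m. path_iter V g m t w)"
  by (intro incseq_SucI path_iter_Suc_le)

lemma jump_path_first: "t < s 0 \<Longrightarrow> jump_path y s t = Some (y 0)"
proof -
  assume t: "t < s 0"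
  then have t0: "t < (\<Sum>i\<le>0. s i)" by simp
  then have "(LEAST n. t < (\<Sum>i\<le>n. s i)) = 0" by (rule Least_eq_0)
  moreover have "\<exists>n. t < (\<Sum>i\<le>n. s i)" using t0 by (rule exI)
  ultimately show ?thesis by (simp add: jump_path_def)
qed

lemma jump_path_shift:
  assumes "s 0 \<le> t"
  shows "jump_path y s t = jump_path (\<lambda>n. y (Suc n)) (\<lambda>n. s (Suc n)) (t - s 0)"
proof -
  define Q where "Q n \<longleftrightarrow> t < (\<Sum>i\<le>n. s i)" for n
  have Q0: "\<not> Q 0" using assms by (simp add: Q_def)
  have QS: "Q (Suc n) \<longleftrightarrow> t - s 0 < (\<Sum>i\<le>n. s (Suc i))" for n
    unfolding Q_def sum.atMost_Suc_shift by auto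
  have ex: "(\<exists>n. Q n) \<longleftrightarrow> (\<exists>n. Q (Suc n))" using Q0 by (metis not0_implies_Suc)
  have least: "(LEAST n. Q n) = Suc (LEAST n. Q (Suc n))" if "Q n" for n
    using that Q0 by (rule Least_Suc)
  show ?thesis
    unfolding jump_path_def Q_def[symmetric] QS[symmetric] ex using least by auto
qed

lemma path_iter_before_first_jump:
  assumes t: "0 \<le> t" "t < s 0"
  shows "\<exists>I. has_bochner_integral lborel (\<lambda>\<sigma>. indicator {0..t} \<sigma> * ext V (jump_path y s \<sigma>)) I \<and>
    path_iter V g (Suc n) t (\<lambda>i. (y i, s i)) = ennreal (ext g (jump_path y s t) * exp (- I))"
proof -
  have "has_bochner_integral lborel (\<lambda>\<sigma>. indicator {0..t} \<sigma> * V (y 0)) (measure lborel {0..t} * V (y 0))"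
    by (intro has_bochner_integral_mult_left has_bochner_integral_real_indicator)
       (simp_all add: emeasure_lborel_Icc_eq)
  moreover have "indicator {0..t} \<sigma> * V (y 0) = indicator {0..t} \<sigma> * ext V (jump_path y s \<sigma>)" for \<sigma> :: real
    using t by (auto simp: jump_path_first ext_def split: split_indicator)
  ultimately have "has_bochner_integral lborel (\<lambda>\<sigma>. indicator {0..t} \<sigma> * ext V (jump_path y s \<sigma>)) (t * V (y 0))"
    using t by simp
  then show ?thesis using t
    by (intro exI[of _ "t * V (y 0)"]) (simp add: jump_path_first ext_def mult.commute)
qed

text \<open>
  The path is a step function on [0, t], so its potential integral exists; the induction carries integrability along, since
  the Lebesgue integral of a non-integrable function would be the default value 0.
\<close>

lemma path_iter_before_explosion:
  assumes "\<And>i. 0 < s i" "0 \<le> t" "t < (\<Sum>i\<le>n. s i)"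
  shows "\<exists>I. has_bochner_integral lborel (\<lambda>\<sigma>. indicator {0..t} \<sigma> * ext V (jump_path y s \<sigma>)) I \<and>
    path_iter V g (Suc n) t (\<lambda>i. (y i, s i)) = ennreal (ext g (jump_path y s t) * exp (- I))"
  using assms
proof (induction n arbitrary: y s t)
  case 0
  then show ?case using path_iter_before_first_jump[of t s V y g 0] by simp
next
  case (Suc n)
  show ?case
  proof (cases "t < s 0")
    case True
    show ?thesis by (rule path_iter_before_first_jump) (use True Suc.prems in auto)
  next
    case False
    define y' s' t' where "y' n = y (Suc n)" and "s' n = s (Suc n)" and "t' = t - s 0" for n
    have "t' < (\<Sum>i\<le>n. s' i)"
      using Suc.prems(3) unfolding sum.atMost_Suc_shift by (simp add: t'_def s'_def)
    moreover have "0 < s' i" "0 \<le> t'" for i using Suc.prems(1) False by (auto simp: s'_def t'_def)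
    ultimately obtain I where I: "has_bochner_integral lborel (\<lambda>\<sigma>. indicator {0..t'} \<sigma> * ext V (jump_path y' s' \<sigma>)) I"
      "path_iter V g (Suc n) t' (\<lambda>i. (y' i, s' i)) = ennreal (ext g (jump_path y' s' t') * exp (- I))"
      using Suc.IH[of s' t' y'] by blast
    have shift: "jump_path y s \<sigma> = jump_path y' s' (\<sigma> - s 0)" if "s 0 \<le> \<sigma>" for \<sigma>
      unfolding y'_def s'_def using that by (rule jump_path_shift)
    define h where "h \<sigma> = indicator {0..t'} (\<sigma> - s 0) * ext V (jump_path y' s' (\<sigma> - s 0))" for \<sigma>
    have "has_bochner_integral lborel h I"
      using I(1) lborel_has_bochner_integral_real_affine_iff[of 1 h I "s 0"] by (simp add: h_def)
    moreover have "has_bochner_integral lborel (\<lambda>\<sigma>. indicator {0..<s 0} \<sigma> * V (y 0)) (measure lborel {0..<s 0} * V (y 0))"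
      by (intro has_bochner_integral_mult_left has_bochner_integral_real_indicator)
         (use Suc.prems(1)[of 0] in \<open>simp_all add: less_imp_le\<close>)
    ultimately have "has_bochner_integral lborel (\<lambda>\<sigma>. indicator {0..<s 0} \<sigma> * V (y 0) + h \<sigma>) (s 0 * V (y 0) + I)"
      using Suc.prems(1)[of 0] by (intro has_bochner_integral_add) (auto simp: less_imp_le)
    moreover have "indicator {0..<s 0} \<sigma> * V (y 0) + h \<sigma> = indicator {0..t} \<sigma> * ext V (jump_path y s \<sigma>)" for \<sigma>
      using False Suc.prems(1)[of 0]
      by (cases "\<sigma> < s 0") (auto simp: jump_path_first ext_def h_def t'_def shift split: split_indicator)
    ultimately have "has_bochner_integral lborel (\<lambda>\<sigma>. indicator {0..t} \<sigma> * ext V (jump_path y s \<sigma>)) (s 0 * V (y 0) + I)"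
      by simp
    moreover have "path_iter V g (Suc (Suc n)) t (\<lambda>i. (y i, s i)) =
        ennreal (exp (- (V (y 0) * s 0))) * path_iter V g (Suc n) t' (\<lambda>i. (y' i, s' i))"
      using False by (subst path_iter.simps(2)) (simp add: t'_def y'_def s'_def)
    ultimately show ?thesis
      using False unfolding I(2)
      by (intro exI[of _ "s 0 * V (y 0) + I"])
         (simp add: shift t'_def ennreal_mult'[symmetric] exp_add[symmetric] exp_diff exp_minus field_simps)
  qed
qed

lemma path_iter_after_explosion:
  assumes "\<And>n. (\<Sum>i\<le>n. s i) \<le> t"
  shows "path_iter V g m t (\<lambda>i. (y i, s i)) = 0"
  using assms
proof (induction m arbitrary: y s t)
  case (Suc m)
  have "(\<Sum>i\<le>n. s (Suc i)) \<le> t - s 0" for n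
    using Suc.prems[of "Suc n"] unfolding sum.atMost_Suc_shift by simp
  then have "path_iter V g m (t - s 0) (\<lambda>i. (y (Suc i), s (Suc i))) = 0" by (rule Suc.IH)
  then show ?case using Suc.prems[of 0] by simp
qed simp

text \<open>
  Before explosion the sequence is eventually constant.  After explosion each term is 0, in agreement with the
  value 0 of functions at the cemetery, whatever the integral of the potential is.
\<close>

lemma path_iter_SUP:
  assumes "\<And>i. 0 < s i" "0 \<le> t"
  shows "(SUP m. path_iter V g m t (\<lambda>i. (y i, s i))) =
    ennreal (ext g (jump_path y s t) * exp (- (LINT \<sigma>:{0..t}|lborel. ext V (jump_path y s \<sigma>))))" (is "_ = ?R")
proof (cases "\<exists>n. t < (\<Sum>i\<le>n. s i)")
  case True
  then obtain n where n: "t < (\<Sum>i\<le>n. s i)" by blast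
  have "path_iter V g (Suc m) t (\<lambda>i. (y i, s i)) = ?R" if "n \<le> m" for m
  proof -
    have "(\<Sum>i\<le>n. s i) \<le> (\<Sum>i\<le>m. s i)"
      using that assms(1) by (intro sum_mono2) (auto simp: less_imp_le)
    then have "t < (\<Sum>i\<le>m. s i)" using n by linarith
    from path_iter_before_explosion[OF assms this, of V y g] obtain I
      where I: "has_bochner_integral lborel (\<lambda>\<sigma>. indicator {0..t} \<sigma> * ext V (jump_path y s \<sigma>)) I"
        "path_iter V g (Suc m) t (\<lambda>i. (y i, s i)) = ennreal (ext g (jump_path y s t) * exp (- I))" by blast
    have "(LINT \<sigma>:{0..t}|lborel. ext V (jump_path y s \<sigma>)) = I"
      using has_bochner_integral_integral_eq[OF I(1)] by (simp add: set_lebesgue_integral_def)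
    then show ?thesis using I(2) by simp
  qed
  note ev = this
  have "(\<lambda>m. path_iter V g m t (\<lambda>i. (y i, s i))) \<longlonglongrightarrow> (SUP m. path_iter V g m t (\<lambda>i. (y i, s i)))"
    by (intro LIMSEQ_SUP incseq_path_iter)
  moreover have "(\<lambda>m. path_iter V g m t (\<lambda>i. (y i, s i))) \<longlonglongrightarrow> ?R"
  proof (rule tendsto_eventually, rule eventually_sequentiallyI[of "Suc n"])
    fix m assume "Suc n \<le> m"
    then obtain k where "m = Suc k" "n \<le> k" by (cases m) auto
    then show "path_iter V g m t (\<lambda>i. (y i, s i)) = ?R" using ev[of k] by simp
  qed
  ultimately show ?thesis by (rule LIMSEQ_unique)
next
  case False
  then have "path_iter V g m t (\<lambda>i. (y i, s i)) = 0" for m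
    by (intro path_iter_after_explosion) (simp add: not_less)
  moreover have "jump_path y s t = None" using False by (simp add: jump_path_def)
  ultimately show ?thesis by (simp add: ext_def)
qed

lemma fk_functional_nonneg:
  assumes "\<And>y. 0 \<le> g y"
  shows "0 \<le> fk_functional X V t g \<omega>"
  using assms by (auto simp: fk_functional_def ext_def split: option.splits)

context bd_chain
begin

text \<open>
  Conditioning on the first jump gives the Picard recursion: survival beyond t contributes exp (- q t), and a jump
  after time s leaves the time t - s, which becomes the integration variable after reflecting the integral.
\<close>

lemma nn_integral_path_iter:
  assumes g: "\<And>y. 0 \<le> g y" and "0 \<le> t"
  shows "(\<integral>\<^sup>+ w. path_iter V g m t w \<partial>path_law x) = fk_iter a b (\<lambda>y. q y + V y) g m t x"
  using \<open>0 \<le> t\<close>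
proof (induction m arbitrary: t x)
  case (Suc m)
  note t = \<open>0 \<le> t\<close>
  interpret m: prob_space "path_law z" for z by (rule prob_path_law)
  let ?I = "fk_iter a b (\<lambda>y. q y + V y) g m"
  define G where "G = g x * exp (- (V x * t))"
  define f where "f s = indicator {0..t} s * ennreal (exp (- ((q x + V x) * s))) *
      (ennreal (a x) * ?I (t - s) (x + 1) + ennreal (b x) * ?I (t - s) (x - 1))" for s
  have *: "{0..t} = {s. 0 \<le> s \<and> s \<le> t}" by auto
  have [measurable]: "f \<in> borel_measurable borel" unfolding f_def * by measurable
  have ab: "0 \<le> a x / q x" "0 \<le> b x / q x" "0 < q x" "a x / q x + b x / q x = 1"
    using a_pos[of x] b_nonneg[of x] q_pos[of x] by (auto simp: q_def add_divide_distrib[symmetric])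
  have inner: "(\<integral>\<^sup>+ w. path_iter V g (Suc m) t (case_nat (x, s) w) \<partial>path_law z) =
      (if t < s then ennreal G else ennreal (exp (- (V x * s))) * ?I (t - s) z)" if "0 \<le> s" for s z
    using Suc.IH[of "t - s" z] m.emeasure_space_1[of z]
    by (auto simp: G_def nn_integral_cmult)
  have point: "ennreal (exponential_density (q x) s) *
      (ennreal (a x / q x) * (\<integral>\<^sup>+ w. path_iter V g (Suc m) t (case_nat (x, s) w) \<partial>path_law (x + 1)) +
       ennreal (b x / q x) * (\<integral>\<^sup>+ w. path_iter V g (Suc m) t (case_nat (x, s) w) \<partial>path_law (x - 1)))
     = ennreal G * (ennreal (exponential_density (q x) s) * indicator {t<..} s) + f s" for s
  proof -
    consider "s < 0" | "0 \<le> s" "s \<le> t" | "t < s" by linarith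
    then show ?thesis
    proof cases
      case 1
      then show ?thesis using t by (simp add: exponential_density_def f_def)
    next
      case 2
      have e: "ennreal (q x * exp (- s * q x)) * (ennreal (c / q x) * (ennreal (exp (- (V x * s))) * r))
        = ennreal (exp (- ((q x + V x) * s))) * (ennreal c * r)" if "0 \<le> c" for c r
      proof -
        have "exp (- ((q x + V x) * s)) = exp (- s * q x) * exp (- (V x * s))"
          by (simp add: exp_add[symmetric] algebra_simps)
        then have R: "q x * exp (- s * q x) * (c / q x * exp (- (V x * s))) = exp (- ((q x + V x) * s)) * c"
          using ab(3) by simp
        have "ennreal A * (ennreal B * (ennreal C * r)) = ennreal (A * (B * C)) * r"
          if "0 \<le> A" "0 \<le> B" "0 \<le> C" for A B C
          using that by (simp add: ennreal_mult mult.assoc)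
        then have "ennreal (q x * exp (- s * q x)) * (ennreal (c / q x) * (ennreal (exp (- (V x * s))) * r))
          = ennreal (q x * exp (- s * q x) * (c / q x * exp (- (V x * s)))) * r"
          using that ab(3) by simp
        then show ?thesis unfolding R using that by (simp add: ennreal_mult mult.assoc)
      qed
      show ?thesis
        using 2 a_pos[of x] b_nonneg[of x]
        by (simp only: inner exponential_density_def f_def)
           (simp add: e[simplified] distrib_left mult.assoc)
    next
      case 3
      have "ennreal (a x / q x) * ennreal G + ennreal (b x / q x) * ennreal G = ennreal G"
        using ab by (simp add: distrib_right[symmetric] ennreal_plus[symmetric] del: ennreal_plus)
      then show ?thesis using 3 t by (simp only: inner f_def) (simp add: mult.commute)
    qed
  qed
  \<comment> \<open>No jump up to time t.\<close>
  have first: "(\<integral>\<^sup>+ s. ennreal (exponential_density (q x) s) * indicator {t<..} s \<partial>lborel) = ennreal (exp (- (q x * t)))"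
  proof -
    interpret h: prob_space "holding x" by (rule prob_holding)
    have "emeasure (holding x) {t<..} = ennreal (exp (- (q x * t)))"
      using holding_greater[of x t] t by (simp add: h.emeasure_eq_measure)
    then show ?thesis unfolding holding_def by (subst (asm) emeasure_density) auto
  qed
  have second: "(\<integral>\<^sup>+ s. f s \<partial>lborel) = (\<integral>\<^sup>+ s. indicator {0..t} s * ennreal (exp (- ((q x + V x) * (t - s)))) *
        (ennreal (a x) * ?I s (x + 1) + ennreal (b x) * ?I s (x - 1)) \<partial>lborel)"
    by (subst nn_integral_real_affine[of f "-1" t])
       (auto intro!: nn_integral_cong simp: f_def split: split_indicator)
  have "(\<integral>\<^sup>+ w. path_iter V g (Suc m) t w \<partial>path_law x) = ennreal G * ennreal (exp (- (q x * t))) + (\<integral>\<^sup>+ s. f s \<partial>lborel)"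
  proof -
    have "(\<integral>\<^sup>+ w. path_iter V g (Suc m) t w \<partial>path_law x) =
        (\<integral>\<^sup>+ s. ennreal G * (ennreal (exponential_density (q x) s) * indicator {t<..} s) + f s \<partial>lborel)"
      by (subst first_step_nn_integral[OF path_iter_measurable']) (simp only: point)
    then show ?thesis by (simp add: nn_integral_add nn_integral_cmult first del: path_iter.simps)
  qed
  also have "ennreal G * ennreal (exp (- (q x * t))) = ennreal (g x * exp (- ((q x + V x) * t)))"
    using g[of x] by (simp add: G_def ennreal_mult[symmetric] mult.assoc exp_add[symmetric] algebra_simps)
  finally show ?case unfolding second by simp
next
  case 0
  show ?case by (subst nn_integral_cong[where v = "\<lambda>_. 0"]) auto
qed

lemma fk_functional_eq_SUP:
  assumes X: "\<And>\<omega> t. \<omega> \<in> space (P x) \<Longrightarrow> 0 \<le> t \<Longrightarrow> X t \<omega> = jump_path (\<lambda>n. Y n \<omega>) (\<lambda>n. S n \<omega>) t"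
    and \<omega>: "\<omega> \<in> space (P x)" and t: "0 \<le> t"
  shows "ennreal (fk_functional X V t g \<omega>) = (SUP m. path_iter V g m t (marked_path \<omega>))"
proof -
  have "(LINT s:{0..t}|lborel. ext V (X s \<omega>)) =
      (LINT s:{0..t}|lborel. ext V (jump_path (\<lambda>n. Y n \<omega>) (\<lambda>n. S n \<omega>) s))"
    by (rule set_lebesgue_integral_cong) (use X \<omega> in auto)
  then show ?thesis
    unfolding fk_functional_def marked_path_def using X \<omega> t S_pos[OF \<omega>]
    by (subst path_iter_SUP) auto
qed

lemma feynman_kac:
  assumes X: "\<And>\<omega> t. \<omega> \<in> space (P x) \<Longrightarrow> 0 \<le> t \<Longrightarrow> X t \<omega> = jump_path (\<lambda>n. Y n \<omega>) (\<lambda>n. S n \<omega>) t"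
    and g: "\<And>y. 0 \<le> g y" and t: "0 \<le> t"
  shows "fk_functional X V t g \<in> borel_measurable (P x)"
    and "(\<integral>\<^sup>+ \<omega>. ennreal (fk_functional X V t g \<omega>) \<partial>P x) = fk_min a b (\<lambda>y. a y + b y + V y) g t x"
proof -
  have eq: "ennreal (fk_functional X V t g \<omega>) = (SUP m. path_iter V g m t (marked_path \<omega>))"
    if "\<omega> \<in> space (P x)" for \<omega>
    using X that t by (rule fk_functional_eq_SUP)
  have [measurable]: "(\<lambda>\<omega>. path_iter V g m t (marked_path \<omega>)) \<in> borel_measurable (P x)" for m
    by (rule measurable_compose[OF marked_path_measurable path_iter_measurable'])
  have "fk_functional X V t g \<omega> = enn2real (SUP m. path_iter V g m t (marked_path \<omega>))" if "\<omega> \<in> space (P x)" for \<omega>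
    using eq[OF that] fk_functional_nonneg[of g, OF g, of X V t \<omega>] by (metis enn2real_ennreal)
  then show "fk_functional X V t g \<in> borel_measurable (P x)"
    by (subst measurable_cong) auto
  have "(\<integral>\<^sup>+ \<omega>. ennreal (fk_functional X V t g \<omega>) \<partial>P x) = (\<integral>\<^sup>+ \<omega>. (SUP m. path_iter V g m t (marked_path \<omega>)) \<partial>P x)"
    by (rule nn_integral_cong) (rule eq)
  also have "\<dots> = (SUP m. \<integral>\<^sup>+ \<omega>. path_iter V g m t (marked_path \<omega>) \<partial>P x)"
    by (rule nn_integral_monotone_convergence_SUP)
       (use incseq_path_iter in \<open>auto simp: incseq_def le_fun_def\<close>)
  also have "\<dots> = (SUP m. \<integral>\<^sup>+ w. path_iter V g m t w \<partial>path_law x)"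
    unfolding path_law_def by (subst nn_integral_distr[OF marked_path_measurable]) simp_all
  finally show "(\<integral>\<^sup>+ \<omega>. ennreal (fk_functional X V t g \<omega>) \<partial>P x) = fk_min a b (\<lambda>y. a y + b y + V y) g t x"
    unfolding fk_min_def nn_integral_path_iter[OF g t] q_def .
qed

end

theorem birth_death_feynman_kac:
  assumes bd: "birth_death_process a b P X" and rates: "\<And>x. 0 < a x" "\<And>x. 0 \<le> b x" "b 0 = 0"
    and g: "\<And>y. 0 \<le> g y" and t: "0 \<le> t"
  shows "fk_functional X V t g \<in> borel_measurable (P x)"
    and "(\<integral>\<^sup>+ \<omega>. ennreal (fk_functional X V t g \<omega>) \<partial>P x) = fk_min a b (\<lambda>y. a y + b y + V y) g t x"
proof -
  from bd obtain Y S where YS: "\<forall>x.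
        prob_space (P x) \<and>
        (\<forall>n. Y n \<in> P x \<rightarrow>\<^sub>M count_space UNIV) \<and>
        (\<forall>n. S n \<in> borel_measurable (P x)) \<and>
        (\<forall>\<omega>\<in>space (P x). \<forall>n. 0 < S n \<omega>) \<and>
        (\<forall>\<omega>\<in>space (P x). \<forall>t\<ge>0. X t \<omega> = jump_path (\<lambda>n. Y n \<omega>) (\<lambda>n. S n \<omega>) t) \<and>
        (\<forall>n y s. (\<forall>i\<le>n. 0 \<le> s i) \<longrightarrow>
           measure (P x) {\<omega> \<in> space (P x). \<forall>i\<le>n. Y i \<omega> = y i \<and> s i < S i \<omega>} =
             (if y 0 = x then 1 else 0) *
             (\<Prod>i<n. jump_rate (bd_generator a b) (y i) (y (Suc i)) / exit_rate (bd_generator a b) (y i)) *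
             (\<Prod>i\<le>n. exp (- (exit_rate (bd_generator a b) (y i) * s i))))"
    unfolding birth_death_process_def minimal_chain_def by blast
  interpret bd_chain a b P Y S
    by (rule bd_chain.intro) (use YS rates in auto)
  show "fk_functional X V t g \<in> borel_measurable (P x)"
    and "(\<integral>\<^sup>+ \<omega>. ennreal (fk_functional X V t g \<omega>) \<partial>P x) = fk_min a b (\<lambda>y. a y + b y + V y) g t x"
    using feynman_kac[of x X g t V] YS g t by auto
qed

section \<open>The intertwining for the processes\<close>

lemma integrable_of_nn_integral_finite:
  fixes h :: "'w \<Rightarrow> real"
  assumes "h \<in> borel_measurable M" "\<And>\<omega>. 0 \<le> h \<omega>" "(\<integral>\<^sup>+ \<omega>. ennreal (h \<omega>) \<partial>M) = v" "v < \<top>"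
  shows "integrable M h" "(\<integral>\<omega>. h \<omega> \<partial>M) = enn2real v"
proof -
  show "integrable M h" using assms by (intro integrableI_nonneg) auto
  show "(\<integral>\<omega>. h \<omega> \<partial>M) = enn2real v" using assms by (subst integral_eq_nn_integral) auto
qed

lemma fk_functional_zero_potential: "fk_functional X (\<lambda>_. 0) t g = (\<lambda>\<omega>. ext g (X t \<omega>))"
proof -
  have "ext (\<lambda>_. 0) z = 0" for z by (cases z) (auto simp: ext_def)
  then show ?thesis by (simp add: fk_functional_def fun_eq_iff set_lebesgue_integral_def)
qed

lemma fk_functional_diff:
  "fk_functional X V t (\<lambda>y. g y - g' y) \<omega> = fk_functional X V t g \<omega> - fk_functional X V t g' \<omega>"
  by (cases "X t \<omega>") (auto simp: fk_functional_def ext_def algebra_simps)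

lemma fk_functional_abs_le:
  assumes "\<And>y. 0 \<le> V y" "\<And>y. \<bar>g y\<bar> \<le> B" "0 \<le> B"
  shows "\<bar>fk_functional X V t g \<omega>\<bar> \<le> B"
proof -
  have "0 \<le> (LINT s:{0..t}|lborel. ext V (X s \<omega>))"
    unfolding set_lebesgue_integral_def using assms(1)
    by (intro Bochner_Integration.integral_nonneg) (auto simp: ext_def split: option.splits)
  then have "exp (- (LINT s:{0..t}|lborel. ext V (X s \<omega>))) \<le> 1" by simp
  moreover have "\<bar>ext g (X t \<omega>)\<bar> \<le> B" using assms by (auto simp: ext_def split: option.splits)
  ultimately have "\<bar>ext g (X t \<omega>)\<bar> * exp (- (LINT s:{0..t}|lborel. ext V (X s \<omega>))) \<le> B * 1"
    by (intro mult_mono) auto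
  then show ?thesis by (simp add: fk_functional_def abs_mult)
qed

text \<open>
  The function exp (c s) \<phi> (r exp (- s)) of s is decreasing: its derivative is
  exp (c s) (c \<phi> \<rho> - \<phi>' \<rho> \<rho>) at \<rho> = r exp (- s).
\<close>

lemma dissipation_bound:
  fixes \<phi> :: "real \<Rightarrow> real"
  assumes diff: "\<And>r. \<phi> field_differentiable (at r)"
    and dis: "\<And>r. deriv \<phi> r * r \<ge> c * \<phi> r" and "0 \<le> \<tau>"
  shows "\<phi> (r * exp (- \<tau>)) \<le> exp (- (c * \<tau>)) * \<phi> r"
proof -
  define h where "h s = exp (c * s) * \<phi> (r * exp (- s))" for s
  have "h \<tau> \<le> h 0"
  proof (rule DERIV_nonpos_imp_nonincreasing[OF \<open>0 \<le> \<tau>\<close>])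
    fix s
    define \<rho> where "\<rho> = r * exp (- s)"
    have "(\<phi> has_real_derivative deriv \<phi> \<rho>) (at \<rho>)"
      using diff by (simp add: DERIV_deriv_iff_field_differentiable)
    moreover have "((\<lambda>s. r * exp (- s)) has_real_derivative - \<rho>) (at s)"
      by (auto intro!: derivative_eq_intros simp: \<rho>_def)
    ultimately have "((\<lambda>s. \<phi> (r * exp (- s))) has_real_derivative deriv \<phi> \<rho> * - \<rho>) (at s)"
      unfolding \<rho>_def by (rule DERIV_chain2)
    then have "(h has_real_derivative exp (c * s) * (c * \<phi> \<rho> - deriv \<phi> \<rho> * \<rho>)) (at s)"
      unfolding h_def by (auto intro!: derivative_eq_intros simp: \<rho>_def algebra_simps)
    moreover have "exp (c * s) * (c * \<phi> \<rho> - deriv \<phi> \<rho> * \<rho>) \<le> 0"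
      using dis[of \<rho>] by (simp add: mult_le_0_iff)
    ultimately show "\<exists>y. (h has_real_derivative y) (at s) \<and> y \<le> 0" by blast
  qed
  then have "exp (- (c * \<tau>)) * (exp (c * \<tau>) * \<phi> (r * exp (- \<tau>))) \<le> exp (- (c * \<tau>)) * \<phi> r"
    unfolding h_def by (intro mult_left_mono) auto
  then show ?thesis by (simp add: mult.assoc[symmetric] exp_add[symmetric])
qed

theorem theorem2p1:
  fixes lam nu u f :: "nat \<Rightarrow> real"
    and P :: "nat \<Rightarrow> 'a measure" and X :: "real \<Rightarrow> 'a \<Rightarrow> nat option"
    and Pu :: "nat \<Rightarrow> 'b measure" and Xu :: "real \<Rightarrow> 'b \<Rightarrow> nat option"
    and x :: nat and t :: real
  assumes "bd_irreducible lam nu"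
    and "bd_nonexplosive lam nu"
    and "birth_death_process lam nu P X"
    and "\<And>y. 0 < u y"
    and "birth_death_process (mod_birth u lam) (mod_death u nu) Pu Xu"
    and "\<And>y s. 0 \<le> s \<Longrightarrow>
           integrable (Pu y)
             (\<lambda>\<omega>. ext (\<lambda>z. mod_birth u lam z + mod_death u nu z + \<bar>potential u lam nu z\<bar>) (Xu s \<omega>))"
    and "bdd_below (range (potential u lam nu))"
    and "bdd_above (range (\<lambda>y. \<bar>u_grad u f y\<bar>))"
    and "0 \<le> t"
  shows "(\<forall>y. integrable (P y) (\<lambda>\<omega>. ext f (X t \<omega>))) \<and>
         integrable (Pu x) (fk_functional Xu (potential u lam nu) t (u_grad u f)) \<and>
         u_grad u (chain_semigroup P X t f) x = fk_semigroup Pu Xu (potential u lam nu) t (u_grad u f) x \<and>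
         (\<forall>\<phi> :: real \<Rightarrow> real. \<forall>c :: real.
            smooth_fun \<phi> \<and> convex_on UNIV \<phi> \<and> 0 < c \<and> (\<forall>r. deriv \<phi> r * r \<ge> c * \<phi> r) \<and>
            (\<forall>y. 0 \<le> potential u lam nu y) \<longrightarrow>
            integrable (Pu x)
              (fk_functional Xu (\<lambda>y. c * potential u lam nu y) t (\<lambda>y. \<phi> (u_grad u f y))) \<and>
            \<phi> (u_grad u (chain_semigroup P X t f) x) \<le>
              fk_semigroup Pu Xu (\<lambda>y. c * potential u lam nu y) t (\<lambda>y. \<phi> (u_grad u f y)) x)"
proof -
  note t = \<open>0 \<le> t\<close> and u_pos = \<open>\<And>y. 0 < u y\<close>
  have lam: "0 < lam y" and nu: "0 \<le> nu y" and nu0: "nu 0 = 0" for y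
    using assms(1) by (auto simp: bd_irreducible_def intro: less_imp_le) (cases y; auto intro: less_imp_le)
  obtain K0 where K0: "\<And>y. K0 \<le> potential u lam nu y" using assms(7) by (auto simp: bdd_below_def)
  obtain C where C: "\<And>y. \<bar>u_grad u f y\<bar> \<le> C" using assms(8) by (auto simp: bdd_above_def)
  have C0: "0 \<le> C" using C[of 0] by linarith
  interpret modified_rates lam nu u "- K0"
    by unfold_locales (use lam nu nu0 u_pos K0 assms(2) in auto)
  have mod_death_0: "mod_death u nu 0 = 0" by (simp add: mod_death_def nu0)
  let ?V = "potential u lam nu"
  have rate: "(\<lambda>y. mod_birth u lam y + mod_death u nu y + ?V y) = (\<lambda>y. nu (y + 1) + lam y)"
    by (simp add: potential_def)

  have E: "integrable (P y) (\<lambda>\<omega>. ext h (X t \<omega>))" "(\<integral>\<omega>. ext h (X t \<omega>) \<partial>P y) = enn2real (sem h t y)"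
    if h: "\<And>z. 0 \<le> h z" and fin: "sem h t y < \<top>" for h y
  proof -
    note fk = birth_death_feynman_kac[OF assms(3) lam nu nu0 h t, where V = "\<lambda>_. 0", unfolded fk_functional_zero_potential add_0_right]
    have nn: "0 \<le> ext h (X t \<omega>)" for \<omega> using h by (auto simp: ext_def split: option.splits)
    show "integrable (P y) (\<lambda>\<omega>. ext h (X t \<omega>))" "(\<integral>\<omega>. ext h (X t \<omega>) \<partial>P y) = enn2real (sem h t y)"
      using integrable_of_nn_integral_finite[OF fk(1) nn fk(2) fin] by blast+
  qed
  have Eu: "integrable (Pu x) (fk_functional Xu ?V t g)"
    "(\<integral>\<omega>. fk_functional Xu ?V t g \<omega> \<partial>Pu x) = enn2real (usem g t x)"
    if g: "\<And>z. 0 \<le> g z" "\<And>z. g z \<le> C" for g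
  proof -
    note fk = birth_death_feynman_kac[OF assms(5) mod_birth_pos mod_death_nonneg mod_death_0 g(1) t, where V = ?V, unfolded rate]
    have "usem g t x \<le> ennreal (exp (- K0 * t) * max C 1)"
      using g t by (intro usem_le) (auto intro: le_max_iff_disj[THEN iffD2])
    then have fin: "usem g t x < \<top>" by (rule le_less_trans) simp
    show "integrable (Pu x) (fk_functional Xu ?V t g)"
      "(\<integral>\<omega>. fk_functional Xu ?V t g \<omega> \<partial>Pu x) = enn2real (usem g t x)"
      using integrable_of_nn_integral_finite[OF fk(1) fk_functional_nonneg[OF g(1)] fk(2) fin] by blast+
  qed

  \<comment> \<open>The increasing functions whose gradients are the positive and the negative part of the gradient of f.\<close>
  define fp where "fp z = (\<Sum>y<z. max (fwd_diff f y) 0)" for z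
  define fn where "fn z = (\<Sum>y<z. max (- fwd_diff f y) 0)" for z
  have f_eq: "f z = f 0 + fp z - fn z" for z
    by (induction z) (auto simp: fp_def fn_def fwd_diff_def max_def)
  have fpn: "0 \<le> fp z" "0 \<le> fn z" "fp 0 = 0" "fn 0 = 0" for z
    by (auto simp: fp_def fn_def intro: sum_nonneg)
  have gp: "u_grad u fp y = max (u_grad u f y) 0" and gn: "u_grad u fn y = max (- u_grad u f y) 0" for y
    using u_pos[of y]
    by (auto simp: u_grad_def fp_def fn_def fwd_diff_def max_def divide_simps mult_le_0_iff zero_le_mult_iff)
  have gpn: "0 \<le> u_grad u fp y" "u_grad u fp y \<le> C" "0 \<le> u_grad u fn y" "u_grad u fn y \<le> C" for y
    using C[of y] C0 unfolding gp gn by auto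
  note inc_p = increasing_intertwining[OF fpn(3) gpn(1,2) t]
  note inc_n = increasing_intertwining[OF fpn(4) gpn(3,4) t]
  have one: "sem (\<lambda>_. 1) t y = 1" for y by (rule sem_one_of_nonexplosive[OF nonexplosive t])
  have ext_f: "(\<lambda>\<omega>. ext f (X t \<omega>)) =
      (\<lambda>\<omega>. f 0 * ext (\<lambda>_. 1) (X t \<omega>) + ext fp (X t \<omega>) - ext fn (X t \<omega>))"
  proof
    fix \<omega>
    show "ext f (X t \<omega>) = f 0 * ext (\<lambda>_. 1) (X t \<omega>) + ext fp (X t \<omega>) - ext fn (X t \<omega>)"
    proof (cases "X t \<omega>")
      case (Some y)
      then show ?thesis using f_eq[of y] by (simp add: ext_def)
    qed (simp add: ext_def)
  qed
  have int_f: "integrable (P y) (\<lambda>\<omega>. ext f (X t \<omega>))" for y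
    unfolding ext_f using one
    by (intro Bochner_Integration.integrable_diff Bochner_Integration.integrable_add integrable_mult_right E fpn inc_p inc_n) auto
  have Ef: "chain_semigroup P X t f y = f 0 + enn2real (sem fp t y) - enn2real (sem fn t y)" for y
    unfolding chain_semigroup_def ext_f
    using E[of "\<lambda>_. 1" y] E[of fp y] E[of fn y] one fpn inc_p(1) inc_n(1) by simp

  have fk_f: "fk_functional Xu ?V t (u_grad u f) =
      (\<lambda>\<omega>. fk_functional Xu ?V t (u_grad u fp) \<omega> - fk_functional Xu ?V t (u_grad u fn) \<omega>)"
  proof -
    have e: "u_grad u f = (\<lambda>y. u_grad u fp y - u_grad u fn y)" by (auto simp: gp gn fun_eq_iff)
    show ?thesis unfolding fk_functional_diff[symmetric] e[symmetric] ..
  qed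
  have int_g: "integrable (Pu x) (fk_functional Xu ?V t (u_grad u f))"
    unfolding fk_f by (intro Bochner_Integration.integrable_diff Eu gpn)
  have "fk_semigroup Pu Xu ?V t (u_grad u f) x =
      enn2real (usem (u_grad u fp) t x) - enn2real (usem (u_grad u fn) t x)"
    unfolding fk_semigroup_def fk_f using gpn by (simp add: Eu)
  moreover have "u_grad u (chain_semigroup P X t f) x =
      1 / u x * (u x * enn2real (usem (u_grad u fp) t x) - u x * enn2real (usem (u_grad u fn) t x))"
    unfolding u_grad_def[of u "chain_semigroup P X t f"] fwd_diff_def Ef inc_p(2)[symmetric] inc_n(2)[symmetric]
    by simp
  ultimately have main: "u_grad u (chain_semigroup P X t f) x = fk_semigroup Pu Xu ?V t (u_grad u f) x"
    using u_pos[of x] by (simp add: right_diff_distrib)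

  have "integrable (Pu x) (fk_functional Xu (\<lambda>y. c * ?V y) t (\<lambda>y. \<phi> (u_grad u f y))) \<and>
      \<phi> (u_grad u (chain_semigroup P X t f) x) \<le>
        fk_semigroup Pu Xu (\<lambda>y. c * ?V y) t (\<lambda>y. \<phi> (u_grad u f y)) x"
    if smooth: "smooth_fun \<phi>" and conv: "convex_on UNIV \<phi>" and c: "0 < c"
      and dis: "\<And>r. deriv \<phi> r * r \<ge> c * \<phi> r" and V: "\<And>y. 0 \<le> ?V y" for \<phi> :: "real \<Rightarrow> real" and c :: real
  proof -
    interpret prob_space "Pu x" using assms(5) unfolding birth_death_process_def minimal_chain_def by blast
    let ?w = "u_grad u f"
    let ?F = "fk_functional Xu (\<lambda>y. c * ?V y) t (\<lambda>y. \<phi> (?w y))"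
    let ?Z = "fk_functional Xu ?V t ?w"
    have diff: "\<phi> field_differentiable (at r)" for r
      using smooth unfolding smooth_fun_def by (metis funpow_0)
    have cont: "continuous_on A \<phi>" for A
      by (intro continuous_at_imp_continuous_on ballI field_differentiable_imp_continuous_at diff)
    have "compact (\<phi> ` {- C..C})" by (intro compact_continuous_image cont compact_Icc)
    then obtain B where B: "\<And>r. r \<in> {- C..C} \<Longrightarrow> \<bar>\<phi> r\<bar> \<le> B"
      using compact_imp_bounded[of "\<phi> ` {- C..C}"] unfolding bounded_iff by (metis imageI real_norm_def)
    have B0: "0 \<le> B" using B[of 0] C0 by force
    have wB: "\<bar>\<phi> (?w y)\<bar> \<le> B" for y using C[of y] by (intro B) auto
    have F_meas: "?F \<in> borel_measurable (Pu x)"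
    proof -
      have e: "(\<lambda>y. max (\<phi> (?w y)) 0 - max (- \<phi> (?w y)) 0) = (\<lambda>y. \<phi> (?w y))"
        by (auto simp: fun_eq_iff)
      have "?F = (\<lambda>\<omega>. fk_functional Xu (\<lambda>y. c * ?V y) t (\<lambda>y. max (\<phi> (?w y)) 0) \<omega> -
          fk_functional Xu (\<lambda>y. c * ?V y) t (\<lambda>y. max (- \<phi> (?w y)) 0) \<omega>)"
        unfolding fk_functional_diff[symmetric] e ..
      then show ?thesis
        using birth_death_feynman_kac(1)[OF assms(5) mod_birth_pos mod_death_nonneg mod_death_0 _ t] by simp
    qed
    have F_bound: "\<bar>?F \<omega>\<bar> \<le> B" for \<omega>
      using c V wB B0 by (intro fk_functional_abs_le) auto
    have int_F: "integrable (Pu x) ?F"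
      by (rule integrable_const_bound[of _ B]) (use F_bound F_meas in auto)
    have Z_bound: "\<bar>?Z \<omega>\<bar> \<le> C" for \<omega>
      using V C C0 by (intro fk_functional_abs_le) auto
    have \<phi>_meas: "\<phi> \<in> borel_measurable borel"
      by (rule borel_measurable_continuous_onI[OF cont])
    have int_\<phi>Z: "integrable (Pu x) (\<lambda>\<omega>. \<phi> (?Z \<omega>))"
    proof (rule integrable_const_bound[of _ B])
      show "AE \<omega> in Pu x. norm (\<phi> (?Z \<omega>)) \<le> B"
      proof (intro always_eventually allI)
        fix \<omega>
        have "?Z \<omega> \<in> {- C..C}" using Z_bound[of \<omega>] by (simp add: abs_le_iff minus_le_iff)
        then show "norm (\<phi> (?Z \<omega>)) \<le> B" using B by simp
      qed
      show "(\<lambda>\<omega>. \<phi> (?Z \<omega>)) \<in> borel_measurable (Pu x)"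
        using int_g \<phi>_meas by (intro measurable_compose[OF _ \<phi>_meas]) auto
    qed
    have point: "\<phi> (?Z \<omega>) \<le> ?F \<omega>" for \<omega>
    proof (cases "Xu t \<omega>")
      \<comment> \<open>After explosion both functionals have the factor 0, and the hypothesis at 0 gives \<phi> 0 \<le> 0.\<close>
      case None
      then show ?thesis using dis[of 0] c by (simp add: fk_functional_def ext_def mult_le_0_iff)
    next
      case (Some y)
      define I where "I = (LINT s:{0..t}|lborel. ext ?V (Xu s \<omega>))"
      have "0 \<le> I"
        unfolding I_def set_lebesgue_integral_def using V
        by (intro Bochner_Integration.integral_nonneg) (auto simp: ext_def split: option.splits)
      moreover have cI: "(LINT s:{0..t}|lborel. ext (\<lambda>y. c * ?V y) (Xu s \<omega>)) = c * I"
      proof -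
        have "ext (\<lambda>y. c * ?V y) z = c * ext ?V z" for z by (cases z) (auto simp: ext_def)
        then show ?thesis by (simp add: I_def)
      qed
      moreover have "?Z \<omega> = ?w y * exp (- I)" "?F \<omega> = \<phi> (?w y) * exp (- (c * I))"
        unfolding fk_functional_def cI I_def[symmetric] Some by (simp_all add: ext_def)
      ultimately show ?thesis
        using dissipation_bound[OF diff dis, of I "?w y"] by (simp add: mult.commute)
    qed
    have "\<phi> (fk_semigroup Pu Xu ?V t ?w x) \<le> (\<integral>\<omega>. \<phi> (?Z \<omega>) \<partial>Pu x)"
      unfolding fk_semigroup_def
      by (rule jensens_inequality[where I = UNIV]) (use int_g int_\<phi>Z conv in auto)
    also have "\<dots> \<le> (\<integral>\<omega>. ?F \<omega> \<partial>Pu x)"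
      by (intro integral_mono int_\<phi>Z int_F point)
    finally show ?thesis using int_F main by (simp add: fk_semigroup_def)
  qed
  then show ?thesis using int_f int_g main by blast
qed

end
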